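(* Let $A\in\mathbb{R}^{m\times n}$, let $h:\mathbb{R}^m\to\mathbb{R}_+$ be a continuous convex function, and let $(\bar b,\bar\lambda)\in\mathbb{R}^m\times\mathbb{R}_{++}$. Suppose that there is $\bar x\in S(\bar b,\bar\lambda)$ such that $h$ is twice continuously differentiable around $A\bar x-\bar b$, $$\ker(\nabla^2h(A\bar x-\bar b))\cap \mathrm{rge}(A_{J_h})=\{0\},\qquad J_h:=\{i\in[n]: |A_i^T\nabla h(A\bar x-\bar b)|=\bar\lambda\},$$ and $A_{J_h}$ has full column rank. (i) Then $S$ is locally single-valued and Lipschitz around $(\bar b,\bar\lambda)$. (ii) If moreover $J_h=\mathrm{supp}(\bar x)$, then $S$ is continuously differentiable at $(\bar b,\bar\lambda)$.
   Context: $\mathbb{R}_+=[0,\infty)$, $\mathbb{R}_{++}=(0,\infty)$, $[n]=\{1,\dots,n\}$; $\|\cdot\|_1$ is the $\ell_1$-norm. For $(b,\lambda)\in\mathbb{R}^m\times\mathbb{R}_+$, $S(b,\lambda):=\mathrm{argmin}_{x\in\mathbb{R}^n}\{h(Ax-b)+\lambda\|x\|_1\}$ (a set-valued mapping). $\mathrm{supp}(x)=\{i\in[n]:x_i\ne0\}$. $A_i$ is the $i$-th column of $A$; for $I\subset[n]$, $A_I$ is the submatrix of columns of $A$ indexed by $I$, with range $\mathrm{rge}(A_I)$; for $I=\emptyset$ the range is $\{0\}$ and $A_I$ is regarded as having full column rank. "Locally single-valued and Lipschitz around $(\bar b,\bar\lambda)$" means that there is a neighborhood of $(\bar b,\bar\lambda)$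 on which $S(b,\lambda)$ is a singleton and, as a function, $S$ is Lipschitz continuous. In (ii), singleton values of $S$ are identified with their unique elements. *)

theory Defs
  imports "HOL-Analysis.Analysis"
begin

definition l1_norm :: "real^'n \<Rightarrow> real" where
  "l1_norm x = (\<Sum>i\<in>UNIV. \<bar>x $ i\<bar>)"

definition supp :: "real^'n \<Rightarrow> 'n set" where
  "supp x = {i. x $ i \<noteq> 0}"

(* The solution map S. Its domain is real^'m * [0,\<infinity>): negative second arguments are
   meaningful only to the type checker and are excluded where S is used, see sol_dom. *)
definition sol_map ::
    "(real^'m \<Rightarrow> real) \<Rightarrow> real^'n^'m \<Rightarrow> (real^'m) \<times> real \<Rightarrow> (real^'n) set" where
  "sol_map h A = (\<lambda>(b, lam).
     {x. is_arg_min (\<lambda>x. h (A *v x - b) + lam * l1_norm x) (\<lambda>_. True) x})"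

definition sol_dom :: "((real^'m) \<times> real) set" where
  "sol_dom = UNIV \<times> {0..}"

(* The range of the submatrix of A formed by the columns with index in I. *)
definition rge_cols :: "real^'n^'m \<Rightarrow> 'n set \<Rightarrow> (real^'m) set" where
  "rge_cols A I = range (\<lambda>z :: real^'n. \<Sum>i\<in>I. z $ i *\<^sub>R column i A)"

(* Rank equals number of columns. Counting indices, not the set of column vectors,
   matters: repeated columns must violate the condition. *)
definition full_column_rank :: "real^'n^'m \<Rightarrow> 'n set \<Rightarrow> bool" where
  "full_column_rank A I \<longleftrightarrow> dim (rge_cols A I) = card I"

(* gradient and hessian are meaningful only where the respective derivative exists. *)
definition gradient :: "(real^'m \<Rightarrow> real) \<Rightarrow> real^'m \<Rightarrow> real^'m" where
  "gradient h y = (THE g. GDERIV h y :> g)"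

definition hessian :: "(real^'m \<Rightarrow> real) \<Rightarrow> real^'m \<Rightarrow> real^'m^'m" where
  "hessian h y = matrix (frechet_derivative (gradient h) (at y))"

definition cont_diff_on ::
    "'a::real_normed_vector set \<Rightarrow> ('a \<Rightarrow> 'b::real_normed_vector) \<Rightarrow> bool" where
  "cont_diff_on U f \<longleftrightarrow>
     (\<exists>f' :: 'a \<Rightarrow> 'a \<Rightarrow>\<^sub>L 'b.
        (\<forall>x\<in>U. (f has_derivative blinfun_apply (f' x)) (at x)) \<and> continuous_on U f')"

definition twice_cont_diff_around :: "(real^'m \<Rightarrow> real) \<Rightarrow> real^'m \<Rightarrow> bool" where
  "twice_cont_diff_around h y \<longleftrightarrow>
     (\<exists>U. open U \<and> y \<in> U \<and> (\<forall>z\<in>U. h differentiable at z) \<and> cont_diff_on U (gradient h))"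

(* In the next two definitions S is a set-valued mapping with domain D, and s is the function
   obtained by identifying singletons with their elements. *)
definition locally_single_valued_lipschitz ::
    "'a::metric_space set \<Rightarrow> ('a \<Rightarrow> 'b::metric_space set) \<Rightarrow> 'a \<Rightarrow> bool" where
  "locally_single_valued_lipschitz D S p \<longleftrightarrow>
     (\<exists>U s L. open U \<and> p \<in> U \<and> U \<subseteq> D \<and> (\<forall>q\<in>U. S q = {s q}) \<and> L-lipschitz_on U s)"

(* As usual, continuous differentiability at a point means on a neighbourhood of it. *)
definition set_map_cont_diff_at ::
    "'a::real_normed_vector set \<Rightarrow> ('a \<Rightarrow> 'b::real_normed_vector set) \<Rightarrow> 'a \<Rightarrow> bool" where
  "set_map_cont_diff_at D S p \<longleftrightarrow>
     (\<exists>U s. open U \<and> p \<in> U \<and> U \<subseteq> D \<and> (\<forall>q\<in>U. S q = {s q}) \<and> cont_diff_on U s)"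

(* The index set J_h, as a function of the solution x. *)
definition J_set ::
    "(real^'m \<Rightarrow> real) \<Rightarrow> real^'n^'m \<Rightarrow> real^'m \<Rightarrow> real \<Rightarrow> real^'n \<Rightarrow> 'n set" where
  "J_set h A b lam x = {i. \<bar>column i A \<bullet> gradient h (A *v x - b)\<bar> = lam}"

end

theory Submission
  imports Defs
begin

text \<open>
Write \<open>g\<close> for the gradient of \<open>h\<close>, \<open>y\<close> for the residual \<open>A x - b\<close> and \<open>X\<close> for the space of vectors
supported in the index set \<open>J\<close>. First-order optimality of \<open>x\<close> says that the correlations
\<open>column i A \<bullet> g y\<close> have modulus at most \<open>lam\<close> and are equal to \<open>- lam * sgn (x $ i)\<close> on the support
of \<open>x\<close>. So the support lies in \<open>J\<close>, and outside \<open>J\<close> the bound is strict.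

The hypotheses make the quadratic form \<open>w \<mapsto> H (A w) \<bullet> A w\<close> of the Hessian positive definite on \<open>X\<close>.
This uses that a convex function whose Hessian has \<open>H v \<bullet> v = 0\<close> satisfies \<open>H v = 0\<close>
(\<open>convex_hessian_null_vector\<close>).
Since \<open>g\<close> is continuously differentiable, positive definiteness at one point gives strong
monotonicity of \<open>x \<mapsto> g (A x - b)\<close> along \<open>X\<close> on a whole neighbourhood, uniformly in \<open>b\<close>.

Consequently the problem restricted to \<open>X\<close> and to a small ball around \<open>x\<close> has a unique minimizer.
Comparing the variational inequalities for two parameters shows that it is a Lipschitz function
of the parameters (\<open>variational_lipschitz_estimate\<close>). For nearby parameters it lies in the
interior of the ball and the strict bounds outside \<open>J\<close> persist; then it is the only
solution of the full problem (\<open>unique_solution_from_restricted_minimizer\<close>). This is the first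
claim, \<open>local_lipschitz_solution_map\<close>.

If \<open>J\<close> is the support of \<open>x\<close>, nearby solutions are supported in \<open>J\<close> and have the same signs there,
so they satisfy the equations \<open>column i A \<bullet> g (A s - b) = - lam * sgn (x $ i)\<close> for \<open>i\<close> in \<open>J\<close>.
Their linearization is coercive on \<open>X\<close>, and the Lipschitz property of the solution map lets one
read off its derivative, which is continuous (\<open>solution_map_C1_on_fixed_support\<close>).
\<close>

section \<open>Gradients and Hessians of convex functions\<close>

lemma gderiv_gradient:
  fixes h :: "real^'m \<Rightarrow> real"
  assumes "h differentiable at z"
  shows "GDERIV h z :> gradient h z"
proof -
  obtain f' where f': "(h has_derivative f') (at z)"
    using assms by (auto simp: differentiable_def)
  have lin: "linear f'" using f' by (rule has_derivative_linear)
  have "f' = (\<lambda>v. v \<bullet> adjoint f' 1)"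
    using adjoint_works[OF lin, of _ 1] by (simp add: fun_eq_iff)
  then have G: "GDERIV h z :> adjoint f' 1"
    using f' by (simp add: gderiv_def)
  have uniq: "g = adjoint f' 1" if "GDERIV h z :> g" for g
  proof -
    have "(\<lambda>v. v \<bullet> g) = (\<lambda>v. v \<bullet> adjoint f' 1)"
      using that G has_derivative_unique unfolding gderiv_def by blast
    then have "\<forall>v. v \<bullet> g = v \<bullet> adjoint f' 1" by (simp add: fun_eq_iff)
    then show ?thesis using vector_eq_ldot vector_eq_rdot by blast
  qed
  have "gradient h z = adjoint f' 1"
    unfolding gradient_def by (rule the_equality[where P = "\<lambda>g. GDERIV h z :> g", OF G uniq])
  then show ?thesis using G by simp
qed

lemma gderiv_along_line:
  assumes "GDERIV h (y + t *\<^sub>R v) :> g"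
  shows "((\<lambda>t. h (y + t *\<^sub>R v)) has_real_derivative g \<bullet> v) (at t)"
proof -
  have "((\<lambda>t. h (y + t *\<^sub>R v)) has_derivative (\<lambda>s. (s *\<^sub>R v) \<bullet> g)) (at t)"
    by (rule has_derivative_compose[of "\<lambda>t. y + t *\<^sub>R v", OF _ assms[unfolded gderiv_def]])
       (auto intro!: derivative_eq_intros)
  then show ?thesis
    by (simp add: has_field_derivative_def inner_commute mult_commute_abs)
qed

lemma derivative_inner_along_line:
  assumes H: "(g has_derivative H) (at y)"
  shows "((\<lambda>t. g (y + t *\<^sub>R v) \<bullet> u) has_real_derivative H v \<bullet> u) (at 0)"
proof -
  have "((\<lambda>t::real. y + t *\<^sub>R v) has_derivative (\<lambda>t. t *\<^sub>R v)) (at 0)"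
    by (auto intro!: derivative_eq_intros)
  then have "((\<lambda>t. g (y + t *\<^sub>R v)) has_derivative (\<lambda>t. H (t *\<^sub>R v))) (at 0)"
    by (rule has_derivative_compose) (simp add: H)
  then have "((\<lambda>t. g (y + t *\<^sub>R v) \<bullet> u) has_derivative (\<lambda>t. H (t *\<^sub>R v) \<bullet> u)) (at 0)"
    by (rule has_derivative_inner_left)
  moreover have "H (t *\<^sub>R v) \<bullet> u = (H v \<bullet> u) * t" for t
    using has_derivative_linear[OF H] by (simp add: linear_cmul)
  ultimately show ?thesis by (simp add: has_field_derivative_def)
qed

text \<open>Convexity bounds the difference quotients of \<open>h\<close> along the segment from \<open>y\<close> to \<open>z\<close>
by \<open>h z - h y\<close>; their limit is the directional derivative.\<close>

lemma convex_gradient_inequality: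
  fixes h :: "'a::real_inner \<Rightarrow> real"
  assumes conv: "convex_on UNIV h" and g: "GDERIV h y :> g"
  shows "h y + g \<bullet> (z - y) \<le> h z"
proof -
  define v where "v = z - y"
  have "((\<lambda>t. h (y + t *\<^sub>R v)) has_real_derivative g \<bullet> v) (at 0)"
    by (rule gderiv_along_line) (simp add: g)
  then have lim: "((\<lambda>t. (h (y + t *\<^sub>R v) - h y) / t) \<longlongrightarrow> g \<bullet> v) (at_right 0)"
    unfolding has_field_derivative_iff
    by (simp add: filterlim_at_split)
  have "\<forall>\<^sub>F t in at_right (0::real). t < 1 \<and> 0 < t"
    using eventually_at_right_real[of 0 1] by (simp add: eventually_mono)
  then have "\<forall>\<^sub>F t in at_right 0. (h (y + t *\<^sub>R v) - h y) / t \<le> h z - h y"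
  proof eventually_elim
    case (elim t)
    have "h ((1 - t) *\<^sub>R y + t *\<^sub>R z) \<le> (1 - t) * h y + t * h z"
      using elim by (intro convex_onD[OF conv]) auto
    moreover have "(1 - t) *\<^sub>R y + t *\<^sub>R z = y + t *\<^sub>R v"
      by (simp add: v_def algebra_simps)
    ultimately show ?case using elim by (simp add: field_simps)
  qed
  with lim have "g \<bullet> v \<le> h z - h y"
    by (intro tendsto_upperbound) auto
  then show ?thesis by (simp add: v_def)
qed

text \<open>Taylor expansion of second order along a ray, by one application of the rule of de
l'Hospital: the quotient of the derivatives is half of a difference quotient of the
gradient.\<close>

lemma second_order_quotient:
  fixes h :: "'a::real_inner \<Rightarrow> real"
  assumes V: "open V" "y \<in> V" and g: "\<And>z. z \<in> V \<Longrightarrow> GDERIV h z :> g z"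
    and H: "(g has_derivative H) (at y)"
  shows "((\<lambda>t. (h (y + t *\<^sub>R w) - h y - t * (g y \<bullet> w)) / t\<^sup>2) \<longlongrightarrow> (H w \<bullet> w) / 2) (at_right 0)"
proof -
  define f where "f t = h (y + t *\<^sub>R w) - h y - t * (g y \<bullet> w)" for t
  have line: "((\<lambda>t. y + t *\<^sub>R w) \<longlongrightarrow> y) (at_right 0)"
    by (auto intro!: tendsto_eq_intros)
  have inV: "\<forall>\<^sub>F t in at_right 0. y + t *\<^sub>R w \<in> V"
    by (rule topological_tendstoD[OF line V])
  have deriv: "(f has_real_derivative (g (y + t *\<^sub>R w) - g y) \<bullet> w) (at t)"
    if "y + t *\<^sub>R w \<in> V" for t
    unfolding f_def
    by (rule derivative_eq_intros gderiv_along_line g that refl)+ (simp add: inner_diff_left)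
  have "((\<lambda>t. f t / t\<^sup>2) \<longlongrightarrow> (H w \<bullet> w) / 2) (at_right 0)"
  proof (rule lhopital_right)
    have "isCont f 0" using deriv[of 0] V DERIV_isCont by fastforce
    then show "(f \<longlongrightarrow> 0) (at_right 0)"
      by (simp add: isCont_def f_def filterlim_at_split)
    show "((\<lambda>t::real. t\<^sup>2) \<longlongrightarrow> 0) (at_right 0)" by (auto intro!: tendsto_eq_intros)
    show "\<forall>\<^sub>F t in at_right (0::real). t\<^sup>2 \<noteq> 0"
      using eventually_at_right_less[of "0::real"] by eventually_elim auto
    show "\<forall>\<^sub>F t in at_right (0::real). 2 * t \<noteq> 0"
      using eventually_at_right_less[of "0::real"] by eventually_elim auto
    show "\<forall>\<^sub>F t in at_right 0. (f has_real_derivative (g (y + t *\<^sub>R w) - g y) \<bullet> w) (at t)"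
      using inV by eventually_elim (rule deriv)
    show "\<forall>\<^sub>F t in at_right 0. ((\<lambda>t::real. t\<^sup>2) has_real_derivative 2 * t) (at t)"
      by (intro always_eventually) (auto intro!: derivative_eq_intros)
    have "((\<lambda>t. g (y + t *\<^sub>R w) \<bullet> w) has_real_derivative H w \<bullet> w) (at 0)"
      by (rule derivative_inner_along_line[OF H])
    then have "((\<lambda>t. ((g (y + t *\<^sub>R w) - g y) \<bullet> w) / t) \<longlongrightarrow> H w \<bullet> w) (at_right 0)"
      by (simp add: has_field_derivative_iff filterlim_at_split inner_diff_left)
    then have "((\<lambda>t. ((g (y + t *\<^sub>R w) - g y) \<bullet> w) / t / 2) \<longlongrightarrow> (H w \<bullet> w) / 2) (at_right 0)"
      by (intro tendsto_intros) auto
    then show "((\<lambda>t. ((g (y + t *\<^sub>R w) - g y) \<bullet> w) / (2 * t)) \<longlongrightarrow> (H w \<bullet> w) / 2) (at_right 0)"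
      by (simp add: mult.commute)
  qed
  then show ?thesis by (simp add: f_def)
qed

text \<open>The gradient inequality compares \<open>h\<close> at \<open>y + t w\<close> with its linearization at
\<open>y + t v\<close>. Terms of order zero and one cancel; after division by \<open>t\<^sup>2\<close> the limit
\<open>t \<rightarrow> 0\<close> gives the inequality. It is the form in which symmetry of the Hessian enters
below: it turns zeros of the quadratic form into null vectors.\<close>

lemma convex_hessian_cross_inequality:
  fixes h :: "'a::real_inner \<Rightarrow> real"
  assumes conv: "convex_on UNIV h"
    and V: "open V" "y \<in> V" and g: "\<And>z. z \<in> V \<Longrightarrow> GDERIV h z :> g z"
    and H: "(g has_derivative H) (at y)"
  shows "H v \<bullet> w \<le> (H v \<bullet> v) / 2 + (H w \<bullet> w) / 2"
proof -
  have linH: "linear H" using H by (rule has_derivative_linear)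
  define R where "R w t = (h (y + t *\<^sub>R w) - h y - t * (g y \<bullet> w)) / t\<^sup>2" for w and t :: real
  define D where "D t = ((g (y + t *\<^sub>R v) - g y) \<bullet> (w - v)) / t" for t :: real
  have R: "(R w \<longlongrightarrow> (H w \<bullet> w) / 2) (at_right 0)" for w
    unfolding R_def by (rule second_order_quotient[OF V g H])
  have D: "(D \<longlongrightarrow> H v \<bullet> (w - v)) (at_right 0)"
    using derivative_inner_along_line[OF H, of v "w - v"]
    by (simp add: has_field_derivative_iff filterlim_at_split inner_diff_left D_def[abs_def])
  have line: "((\<lambda>t. y + t *\<^sub>R v) \<longlongrightarrow> y) (at_right 0)"
    by (auto intro!: tendsto_eq_intros)
  have inV: "\<forall>\<^sub>F t in at_right 0. y + t *\<^sub>R v \<in> V"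
    by (rule topological_tendstoD[OF line V])
  have "\<forall>\<^sub>F t in at_right 0. D t \<le> R w t - R v t"
    using inV eventually_at_right_less[of "0::real"]
  proof eventually_elim
    case (elim t)
    have "h (y + t *\<^sub>R v) + g (y + t *\<^sub>R v) \<bullet> ((y + t *\<^sub>R w) - (y + t *\<^sub>R v)) \<le> h (y + t *\<^sub>R w)"
      by (rule convex_gradient_inequality[OF conv g[OF elim(1)]])
    moreover have "(y + t *\<^sub>R w) - (y + t *\<^sub>R v) = t *\<^sub>R (w - v)" by (simp add: algebra_simps)
    ultimately have "t * (g (y + t *\<^sub>R v) \<bullet> (w - v)) \<le> h (y + t *\<^sub>R w) - h (y + t *\<^sub>R v)"
      by simp
    then have "t * ((g (y + t *\<^sub>R v) - g y) \<bullet> (w - v)) / t\<^sup>2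
        \<le> ((h (y + t *\<^sub>R w) - h y - t * (g y \<bullet> w)) - (h (y + t *\<^sub>R v) - h y - t * (g y \<bullet> v))) / t\<^sup>2"
      by (intro divide_right_mono) (auto simp: inner_diff_left inner_diff_right algebra_simps)
    then show ?case using elim
      by (simp only: D_def R_def diff_divide_distrib[symmetric]) (simp add: power2_eq_square)
  qed
  then have "H v \<bullet> (w - v) \<le> (H w \<bullet> w) / 2 - (H v \<bullet> v) / 2"
    by (intro tendsto_le[OF _ tendsto_diff[OF R R] D]) auto
  then show ?thesis by (simp add: inner_diff_right)
qed

lemma convex_hessian_nonneg:
  fixes h :: "'a::real_inner \<Rightarrow> real"
  assumes conv: "convex_on UNIV h"
    and V: "open V" "y \<in> V" and g: "\<And>z. z \<in> V \<Longrightarrow> GDERIV h z :> g z"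
    and H: "(g has_derivative H) (at y)"
  shows "0 \<le> H v \<bullet> v"
  using convex_hessian_cross_inequality[OF conv V g H, of 0 v] has_derivative_linear[OF H]
  by (simp add: linear_0)

text \<open>A positive semidefinite operator need not vanish on the zeros of its quadratic form
unless it is symmetric. Here the cross inequality does the work: scaling \<open>w\<close> by a small factor
makes the right-hand side quadratically small while the left-hand side is linear, so
\<open>H v \<bullet> w \<le> 0\<close> for all \<open>w\<close>, in particular for \<open>w = H v\<close>.\<close>

lemma convex_hessian_null_vector:
  fixes h :: "'a::real_inner \<Rightarrow> real"
  assumes conv: "convex_on UNIV h"
    and V: "open V" "y \<in> V" and g: "\<And>z. z \<in> V \<Longrightarrow> GDERIV h z :> g z"
    and H: "(g has_derivative H) (at y)" and null: "H v \<bullet> v = 0"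
  shows "H v = 0"
proof (rule ccontr)
  assume "H v \<noteq> 0"
  have linH: "linear H" using H by (rule has_derivative_linear)
  define w where "w = H v"
  define a where "a = w \<bullet> w"
  define q where "q = H w \<bullet> w"
  have a: "0 < a" using \<open>H v \<noteq> 0\<close> by (simp add: a_def w_def)
  have q: "0 \<le> q" unfolding q_def by (rule convex_hessian_nonneg[OF conv V g H])
  have "t * a \<le> t\<^sup>2 * q / 2" for t
    using convex_hessian_cross_inequality[OF conv V g H, of v "t *\<^sub>R w"] null linH
    by (simp add: linear_cmul a_def q_def w_def power2_eq_square)
  then have le: "t * a \<le> t * (t * q / 2)" for t by (simp add: power2_eq_square mult.assoc)
  \<comment> \<open>Any positive factor below \<open>2 a / q\<close> contradicts the inequality; adding one
    covers the case \<open>q = 0\<close>.\<close>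
  define t where "t = a / (q + 1)"
  have t: "0 < t" using a q by (simp add: t_def)
  then have "a \<le> t * q / 2" using le mult_le_cancel_left_pos by blast
  moreover have "t * q \<le> a" using a q by (simp add: t_def field_simps)
  ultimately show False using a by linarith
qed

section \<open>The l1-norm\<close>

lemma l1_norm_triangle: "l1_norm (x + y) \<le> l1_norm x + l1_norm y"
  unfolding l1_norm_def by (simp add: sum.distrib[symmetric] sum_mono abs_triangle_ineq)

lemma l1_norm_scaleR: "l1_norm (t *\<^sub>R x) = \<bar>t\<bar> * l1_norm x"
  unfolding l1_norm_def by (simp add: sum_distrib_left abs_mult)

lemma l1_norm_convex_combination:
  assumes "0 \<le> t" "t \<le> 1"
  shows "l1_norm (x + t *\<^sub>R (z - x)) \<le> l1_norm x + t * (l1_norm z - l1_norm x)"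
proof -
  have "x + t *\<^sub>R (z - x) = (1 - t) *\<^sub>R x + t *\<^sub>R z" by (simp add: algebra_simps)
  then have "l1_norm (x + t *\<^sub>R (z - x)) \<le> l1_norm ((1 - t) *\<^sub>R x) + l1_norm (t *\<^sub>R z)"
    using l1_norm_triangle by metis
  also have "\<dots> = l1_norm x + t * (l1_norm z - l1_norm x)"
    unfolding l1_norm_scaleR using assms by (simp add: algebra_simps)
  finally show ?thesis .
qed

lemma l1_norm_diff_le:
  fixes x y :: "real^'n"
  shows "\<bar>l1_norm x - l1_norm y\<bar> \<le> real CARD('n) * norm (x - y)"
proof -
  have "\<bar>l1_norm x - l1_norm y\<bar> \<le> (\<Sum>i\<in>UNIV. \<bar>\<bar>x $ i\<bar> - \<bar>y $ i\<bar>\<bar>)"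
    unfolding l1_norm_def sum_subtractf[symmetric] by (rule sum_abs)
  also have "\<dots> \<le> (\<Sum>i\<in>(UNIV::'n set). norm (x - y))"
  proof (rule sum_mono)
    fix i
    have "\<bar>(x - y) $ i\<bar> \<le> norm (x - y)" by (rule component_le_norm_cart)
    then show "\<bar>\<bar>x $ i\<bar> - \<bar>y $ i\<bar>\<bar> \<le> norm (x - y)" by simp
  qed
  finally show ?thesis by simp
qed

lemma continuous_on_l1_norm: "continuous_on S l1_norm"
  unfolding l1_norm_def[abs_def] by (intro continuous_intros)

section \<open>Coordinate subspaces and the column rank\<close>

definition coord_subspace :: "'n set \<Rightarrow> (real^'n) set" where
  "coord_subspace J = {w. \<forall>i. i \<notin> J \<longrightarrow> w $ i = 0}"

definition coord_proj :: "'n set \<Rightarrow> real^'n \<Rightarrow> real^'n" where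
  "coord_proj J w = (\<chi> i. if i \<in> J then w $ i else 0)"

lemma subspace_coord_subspace: "subspace (coord_subspace J)"
  by (auto simp: subspace_def coord_subspace_def)

lemma coord_proj_in: "coord_proj J w \<in> coord_subspace J"
  by (simp add: coord_proj_def coord_subspace_def)

lemma coord_proj_id: "w \<in> coord_subspace J \<Longrightarrow> coord_proj J w = w"
  by (auto simp: coord_proj_def coord_subspace_def vec_eq_iff)

lemma inner_matrix_vector:
  fixes A :: "real^'n^'m"
  shows "g \<bullet> (A *v w) = (\<Sum>i\<in>UNIV. w $ i * (column i A \<bullet> g))"
  by (simp add: matrix_mult_sum inner_sum_right scalar_mult_eq_scaleR inner_commute)

lemma rge_cols_eq_image: "rge_cols A J = (*v) A ` coord_subspace J"
proof (intro equalityI subsetI)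
  fix v assume "v \<in> rge_cols A J"
  then obtain z where "v = (\<Sum>i\<in>J. z $ i *\<^sub>R column i A)" by (auto simp: rge_cols_def)
  also have "\<dots> = A *v coord_proj J z"
    by (simp add: matrix_mult_sum scalar_mult_eq_scaleR coord_proj_def if_distrib[of "\<lambda>c. c *\<^sub>R _"]
        sum.If_cases)
  finally show "v \<in> (*v) A ` coord_subspace J" using coord_proj_in by blast
next
  fix v assume "v \<in> (*v) A ` coord_subspace J"
  then obtain z where z: "z \<in> coord_subspace J" "v = A *v z" by auto
  have "A *v z = (\<Sum>i\<in>J. z $ i *\<^sub>R column i A)"
    unfolding matrix_mult_sum scalar_mult_eq_scaleR
    using z by (intro sum.mono_neutral_right) (auto simp: coord_subspace_def)
  then show "v \<in> rge_cols A J" using z by (auto simp: rge_cols_def)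
qed

text \<open>The columns indexed by \<open>J\<close> span a space of dimension \<open>card J\<close>, so they are pairwise
distinct and independent; a vanishing linear combination of them has zero coefficients.\<close>

lemma full_column_rank_trivial_kernel:
  fixes A :: "real^'n^'m"
  assumes rank: "full_column_rank A J" and w: "w \<in> coord_subspace J" and zero: "A *v w = 0"
  shows "w = 0"
proof -
  let ?B = "(\<lambda>i. column i A) ` J"
  have sub: "rge_cols A J \<subseteq> span ?B"
    unfolding rge_cols_def by (clarify, intro span_sum span_scale span_base) auto
  have "card J \<le> card ?B"
    using rank dim_le_card[OF sub] by (simp add: full_column_rank_def)
  then have inj: "inj_on (\<lambda>i. column i A) J"
    by (intro eq_card_imp_inj_on antisym card_image_le) auto
  have "?B \<subseteq> rge_cols A J"
  proof
    fix v assume "v \<in> ?B"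
    then obtain i where "i \<in> J" "v = column i A" by auto
    then have "axis i 1 \<in> coord_subspace J" "v = A *v axis i 1"
      by (auto simp: coord_subspace_def axis_def matrix_vector_mult_basis[unfolded axis_def])
    then show "v \<in> rge_cols A J" unfolding rge_cols_eq_image by blast
  qed
  then have indep: "independent ?B"
    using sub rank card_image[OF inj]
    by (intro card_le_dim_spanning[of ?B "rge_cols A J"]) (auto simp: full_column_rank_def)
  define u where "u v = w $ (the_inv_into J (\<lambda>i. column i A) v)" for v
  have u: "u (column i A) = w $ i" if "i \<in> J" for i
    using the_inv_into_f_f[OF inj that] by (simp add: u_def)
  have "A *v w = (\<Sum>i\<in>J. w $ i *\<^sub>R column i A)"
    unfolding matrix_mult_sum scalar_mult_eq_scaleR
    using w by (intro sum.mono_neutral_right) (auto simp: coord_subspace_def)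
  then have "(\<Sum>v\<in>?B. u v *\<^sub>R v) = 0"
    using zero u by (simp add: sum.reindex[OF inj])
  then have "u v = 0" if "v \<in> ?B" for v
    using independentD[OF indep, of ?B u v] that by simp
  then have "w $ i = 0" if "i \<in> J" for i using u that by force
  then show "w = 0" using w by (auto simp: coord_subspace_def vec_eq_iff)
qed

section \<open>Local monotonicity of the gradient\<close>

text \<open>The minimum of the form on the compact unit sphere of the subspace is positive;
homogeneity does the rest.\<close>

lemma quadratic_form_coercive_on_subspace:
  fixes T :: "'a::euclidean_space \<Rightarrow> 'b::euclidean_space"
  assumes S: "subspace S" and T: "linear T" and H: "linear H"
    and pos: "\<And>w. w \<in> S \<Longrightarrow> w \<noteq> 0 \<Longrightarrow> 0 < H (T w) \<bullet> T w"
  obtains c where "0 < c" "\<And>w. w \<in> S \<Longrightarrow> c * (norm w)\<^sup>2 \<le> H (T w) \<bullet> T w"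
proof (cases "S \<inter> sphere 0 1 = {}")
  case True
  have "w = 0" if "w \<in> S" for w
  proof (rule ccontr)
    assume "w \<noteq> 0"
    then have "(1 / norm w) *\<^sub>R w \<in> S \<inter> sphere 0 1"
      using that S by (auto simp: subspace_scale)
    then show False using True by auto
  qed
  then show ?thesis using T H that[of 1] by (metis linear_0 inner_zero_right less_numeral_extra(1)
        mult_1 norm_zero order_refl power_zero_numeral)
next
  case False
  have "compact (S \<inter> sphere 0 1)"
    by (simp add: closed_Int_compact closed_subspace S)
  moreover have "continuous_on (S \<inter> sphere 0 1) (\<lambda>w. H (T w) \<bullet> T w)"
    using linear_compose[OF T H] T
    by (intro continuous_on_inner linear_continuous_on)
       (simp_all add: linear_conv_bounded_linear[symmetric] o_def)
  ultimately obtain w0 where w0: "w0 \<in> S \<inter> sphere 0 1"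
    and min: "\<And>w. w \<in> S \<inter> sphere 0 1 \<Longrightarrow> H (T w0) \<bullet> T w0 \<le> H (T w) \<bullet> T w"
    using continuous_attains_inf[of "S \<inter> sphere 0 1" "\<lambda>w. H (T w) \<bullet> T w"] False by blast
  show ?thesis
  proof
    show "0 < H (T w0) \<bullet> T w0" using w0 by (intro pos) auto
    fix w assume w: "w \<in> S"
    show "H (T w0) \<bullet> T w0 * (norm w)\<^sup>2 \<le> H (T w) \<bullet> T w"
    proof (cases "w = 0")
      case False
      then have "(1 / norm w) *\<^sub>R w \<in> S \<inter> sphere 0 1"
        using w S by (auto simp: subspace_scale)
      from min[OF this] have "H (T w0) \<bullet> T w0 \<le> (H (T w) \<bullet> T w) / (norm w)\<^sup>2"
        by (simp add: linear_cmul[OF T] linear_cmul[OF H] power2_eq_square)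
      then show ?thesis using False by (simp add: field_simps)
    qed (simp add: linear_0[OF T])
  qed
qed

text \<open>A continuously differentiable map differs from its derivative at \<open>y\<close> by a map with
small Lipschitz constant near \<open>y\<close>. Hence monotonicity and Lipschitz estimates that hold for the
linear map \<open>g' y\<close> carry over to \<open>g\<close> itself with slightly worse constants.\<close>

lemma C1_strictly_differentiable:
  fixes g :: "'a::euclidean_space \<Rightarrow> 'b::real_normed_vector"
  assumes V: "open V" "y \<in> V"
    and deriv: "\<And>z. z \<in> V \<Longrightarrow> (g has_derivative blinfun_apply (g' z)) (at z)"
    and cont: "continuous_on V g'" and \<eta>: "0 < \<eta>"
  obtains \<epsilon> where "0 < \<epsilon>" "cball y \<epsilon> \<subseteq> V"
    "\<And>z. z \<in> cball y \<epsilon> \<Longrightarrow> norm (g' z - g' y) \<le> \<eta>"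
    "\<And>z z'. z \<in> cball y \<epsilon> \<Longrightarrow> z' \<in> cball y \<epsilon> \<Longrightarrow>
       norm (g z - g z' - g' y (z - z')) \<le> \<eta> * norm (z - z')"
proof -
  obtain e1 where e1: "0 < e1" "cball y e1 \<subseteq> V" using V open_contains_cball by blast
  obtain e2 where e2: "0 < e2" "\<And>z. z \<in> V \<Longrightarrow> dist z y < e2 \<Longrightarrow> dist (g' z) (g' y) < \<eta>"
    using cont V(2) \<eta> unfolding continuous_on_iff by blast
  define \<epsilon> where "\<epsilon> = min e1 (e2 / 2)"
  have \<epsilon>: "0 < \<epsilon>" "cball y \<epsilon> \<subseteq> V" using e1 e2 by (auto simp: \<epsilon>_def)
  have close: "norm (g' z - g' y) \<le> \<eta>" if "z \<in> cball y \<epsilon>" for z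
  proof -
    have "z \<in> V" using that \<epsilon> by blast
    moreover have "dist z y < e2" using that e2(1) by (simp add: \<epsilon>_def dist_commute)
    ultimately show ?thesis using e2(2) by (simp add: dist_norm less_imp_le)
  qed
  have "norm (g z - g z' - g' y (z - z')) \<le> \<eta> * norm (z - z')"
    if "z \<in> cball y \<epsilon>" "z' \<in> cball y \<epsilon>" for z z'
  proof -
    have "norm ((g z - g' y z) - (g z' - g' y z')) \<le> \<eta> * norm (z - z')"
    proof (rule differentiable_bound[where f = "\<lambda>z. g z - g' y z" and S = "cball y \<epsilon>" and f' = "\<lambda>z. blinfun_apply (g' z - g' y)"])
      fix u assume u: "u \<in> cball y \<epsilon>"
      have "(g has_derivative g' u) (at u within cball y \<epsilon>)"
        by (rule has_derivative_at_withinI[OF deriv]) (use u \<epsilon> in blast)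
      then show "((\<lambda>z. g z - g' y z) has_derivative (g' u - g' y)) (at u within cball y \<epsilon>)"
        unfolding minus_blinfun.rep_eq
        by (intro has_derivative_diff bounded_linear_imp_has_derivative blinfun.bounded_linear_right) 
      show "onorm (g' u - g' y) \<le> \<eta>" using close[OF u] by (simp add: norm_blinfun.rep_eq)
    qed (use that in auto)
    then show ?thesis by (simp add: blinfun.diff_right algebra_simps)
  qed
  then show thesis using that \<epsilon> close by blast
qed

section \<open>Optimality as a variational inequality\<close>

definition objective :: "(real^'m \<Rightarrow> real) \<Rightarrow> real^'n^'m \<Rightarrow> real^'m \<Rightarrow> real \<Rightarrow> real^'n \<Rightarrow> real" where
  "objective h A b lam x = h (A *v x - b) + lam * l1_norm x"

text \<open>The change of the objective from \<open>x\<close> to \<open>z\<close> when the smooth part is linearized at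
\<open>x\<close> and the norm is kept: \<open>x\<close> minimizes a convex objective exactly when this is nonnegative for
all \<open>z\<close>.\<close>

definition vi_gap :: "real^'n^'m \<Rightarrow> real^'m \<Rightarrow> real \<Rightarrow> real^'n \<Rightarrow> real^'n \<Rightarrow> real" where
  "vi_gap A g lam x z = g \<bullet> (A *v (z - x)) + lam * (l1_norm z - l1_norm x)"

lemma sol_map_iff: "x \<in> sol_map h A (b, lam) \<longleftrightarrow> (\<forall>z. objective h A b lam x \<le> objective h A b lam z)"
  by (auto simp: sol_map_def is_arg_min_def objective_def not_less)

lemma residual_along_segment:
  fixes A :: "real^'n^'m"
  shows "A *v (x + t *\<^sub>R (z - x)) - b = (A *v x - b) + t *\<^sub>R (A *v (z - x))"
  by (simp add: matrix_vector_right_distrib matrix_vector_mult_scaleR)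

lemma objective_ge_vi_gap:
  assumes conv: "convex_on UNIV h" and g: "GDERIV h (A *v x - b) :> g"
  shows "objective h A b lam x + vi_gap A g lam x z \<le> objective h A b lam z"
  using convex_gradient_inequality[OF conv g, of "A *v z - b"]
  by (simp add: objective_def vi_gap_def matrix_vector_mult_diff_distrib algebra_simps)

text \<open>The one-sided derivative of the objective at \<open>x\<close> towards \<open>z\<close> is at most the gap: the
smooth part contributes its directional derivative, and convexity bounds the difference quotient
of the norm.\<close>

lemma minimizer_vi_gap_nonneg:
  assumes C: "convex C" "x \<in> C" "z \<in> C" and lam: "0 \<le> lam" and g: "GDERIV h (A *v x - b) :> g"
    and min: "\<And>w. w \<in> C \<Longrightarrow> objective h A b lam x \<le> objective h A b lam w"
  shows "0 \<le> vi_gap A g lam x z"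
proof -
  define y where "y = A *v x - b"
  define v where "v = A *v (z - x)"
  have "((\<lambda>t. h (y + t *\<^sub>R v)) has_real_derivative g \<bullet> v) (at 0)"
    by (rule gderiv_along_line) (simp add: g y_def)
  then have "((\<lambda>t. (h (y + t *\<^sub>R v) - h y) / t) \<longlongrightarrow> g \<bullet> v) (at_right 0)"
    unfolding has_field_derivative_iff by (simp add: filterlim_at_split)
  then have lim: "((\<lambda>t. (h (y + t *\<^sub>R v) - h y) / t + lam * (l1_norm z - l1_norm x))
      \<longlongrightarrow> vi_gap A g lam x z) (at_right 0)"
    unfolding vi_gap_def v_def by (intro tendsto_intros)
  have "\<forall>\<^sub>F t in at_right (0::real). t < 1 \<and> 0 < t"
    using eventually_at_right_real[of 0 1] by (simp add: eventually_mono)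
  then have "\<forall>\<^sub>F t in at_right 0. 0 \<le> (h (y + t *\<^sub>R v) - h y) / t + lam * (l1_norm z - l1_norm x)"
  proof eventually_elim
    case (elim t)
    have "(1 - t) *\<^sub>R x + t *\<^sub>R z \<in> C" using C elim by (intro convexD) auto
    then have "x + t *\<^sub>R (z - x) \<in> C" by (simp add: algebra_simps)
    from min[OF this] have "h y + lam * l1_norm x \<le> h (y + t *\<^sub>R v) + lam * l1_norm (x + t *\<^sub>R (z - x))"
      by (simp only: objective_def residual_along_segment y_def v_def)
    also have "\<dots> \<le> h (y + t *\<^sub>R v) + lam * (l1_norm x + t * (l1_norm z - l1_norm x))"
      using l1_norm_convex_combination[of t x z] elim lam by (intro add_left_mono mult_left_mono) auto
    finally show ?case using elim by (simp add: field_simps)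
  qed
  with lim show ?thesis by (intro tendsto_lowerbound) auto
qed

lemma vi_gap_coordinates:
  fixes A :: "real^'n^'m"
  shows "vi_gap A g lam x z =
    (\<Sum>i\<in>UNIV. (z $ i - x $ i) * (column i A \<bullet> g) + lam * (\<bar>z $ i\<bar> - \<bar>x $ i\<bar>))"
  by (simp add: vi_gap_def inner_matrix_vector l1_norm_def sum.distrib sum_subtractf sum_distrib_left[symmetric])

text \<open>The gap is a sum over coordinates, so it is nonnegative in each coordinate
separately; comparing with \<open>x $ i \<plusminus> 1\<close> and with \<open>0\<close> gives the two conditions. They
say that minus the gradient of the smooth part is a subgradient of the weighted norm.\<close>

lemma solution_coordinate_conditions:
  fixes A :: "real^'n^'m"
  assumes gap: "\<And>z. 0 \<le> vi_gap A g lam x z" and lam: "0 \<le> lam"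
  shows "\<bar>column i A \<bullet> g\<bar> \<le> lam"
    and "x $ i \<noteq> 0 \<Longrightarrow> column i A \<bullet> g = - lam * sgn (x $ i)"
proof -
  define c where "c = column i A \<bullet> g"
  have coord: "0 \<le> (s - x $ i) * c + lam * (\<bar>s\<bar> - \<bar>x $ i\<bar>)" for s
  proof -
    define z where "z = (\<chi> j. if j = i then s else x $ j)"
    have "vi_gap A g lam x z =
      (\<Sum>j\<in>UNIV. if j = i then (s - x $ i) * c + lam * (\<bar>s\<bar> - \<bar>x $ i\<bar>) else 0)"
      unfolding vi_gap_coordinates by (rule sum.cong) (auto simp: z_def c_def)
    then show ?thesis using gap[of z] by simp
  qed
  have bound: "0 \<le> t * c + lam * \<bar>t\<bar>" for t
  proof -
    have "lam * (\<bar>x $ i + t\<bar> - \<bar>x $ i\<bar>) \<le> lam * \<bar>t\<bar>"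
      using lam by (intro mult_left_mono) auto
    then show ?thesis using coord[of "x $ i + t"] by simp
  qed
  have le: "\<bar>c\<bar> \<le> lam" using bound[of 1] bound[of "-1"] by (simp add: abs_le_iff)
  then show "\<bar>column i A \<bullet> g\<bar> \<le> lam" by (simp add: c_def)
  assume nz: "x $ i \<noteq> 0"
  have opp: "x $ i * c + lam * \<bar>x $ i\<bar> \<le> 0" using coord[of 0] by simp
  have "c = - lam * sgn (x $ i)"
  proof (cases "0 < x $ i")
    case True
    then have "x $ i * (c + lam) \<le> 0" using opp by (simp add: distrib_left mult.commute)
    then have "c + lam \<le> 0" using True by (simp add: mult_le_0_iff)
    then show ?thesis using True le by simp
  next
    case False
    then have neg: "x $ i < 0" using nz by simp
    then have "x $ i * (c - lam) \<le> 0" using opp by (simp add: right_diff_distrib mult.commute)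
    then have "0 \<le> c - lam" using neg by (simp add: mult_le_0_iff)
    then show ?thesis using neg le by simp
  qed
  then show "column i A \<bullet> g = - lam * sgn (x $ i)" by (simp add: c_def)
qed

lemma short_step_in_subspace:
  fixes x z :: "'a::real_normed_vector"
  assumes X: "subspace X" "x \<in> X" "z \<in> X" and e: "0 < e"
  obtains t where "0 < t" "t \<le> 1" "x + t *\<^sub>R (z - x) \<in> X" "dist x (x + t *\<^sub>R (z - x)) \<le> e"
proof
  define t where "t = min 1 (e / (norm (z - x) + 1))"
  show t: "0 < t" "t \<le> 1" using e by (auto simp: t_def add_nonneg_pos)
  show "x + t *\<^sub>R (z - x) \<in> X" using X by (simp add: subspace_add subspace_diff subspace_scale)
  have "dist x (x + t *\<^sub>R (z - x)) = t * norm (z - x)" using t by (simp add: dist_norm)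
  also have "\<dots> \<le> e / (norm (z - x) + 1) * (norm (z - x) + 1)"
    using e by (intro mult_mono) (auto simp: t_def)
  also have "\<dots> = e" by (simp add: add_nonneg_eq_0_iff)
  finally show "dist x (x + t *\<^sub>R (z - x)) \<le> e" .
qed

text \<open>The gap is convex in \<open>z\<close> and vanishes at \<open>z = x\<close>, so a short step towards \<open>z\<close>
already decides its sign.\<close>

lemma vi_gap_nonneg_from_neighbourhood:
  assumes X: "subspace X" "x \<in> X" "z \<in> X" and e: "0 < e" and lam: "0 \<le> lam"
    and near: "\<And>w. w \<in> X \<Longrightarrow> dist x w \<le> e \<Longrightarrow> 0 \<le> vi_gap A g lam x w"
  shows "0 \<le> vi_gap A g lam x z"
proof -
  obtain t where t: "0 < t" "t \<le> 1"
    and step: "x + t *\<^sub>R (z - x) \<in> X" "dist x (x + t *\<^sub>R (z - x)) \<le> e"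
    using short_step_in_subspace[OF X e] .
  define w where "w = x + t *\<^sub>R (z - x)"
  have "0 \<le> vi_gap A g lam x w" using near step by (simp add: w_def)
  also have "\<dots> \<le> t * vi_gap A g lam x z"
  proof -
    have "lam * (l1_norm w - l1_norm x) \<le> lam * (t * (l1_norm z - l1_norm x))"
      using l1_norm_convex_combination[of t x z] t lam by (intro mult_left_mono) (auto simp: w_def)
    then show ?thesis
      by (simp add: vi_gap_def w_def matrix_vector_mult_scaleR algebra_simps)
  qed
  finally show ?thesis using t by (simp add: zero_le_mult_iff)
qed

text \<open>If \<open>x\<close> is supported in \<open>J\<close>, the coordinates of \<open>z\<close> outside \<open>J\<close> contribute to the gap
independently of the others.\<close>

lemma vi_gap_split_coord_proj:
  fixes A :: "real^'n^'m"
  assumes x: "x \<in> coord_subspace J"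
  shows "vi_gap A g lam x z = vi_gap A g lam x (coord_proj J z)
    + (\<Sum>i\<in>-J. z $ i * (column i A \<bullet> g) + lam * \<bar>z $ i\<bar>)"
proof -
  have split: "(\<Sum>i\<in>UNIV. f i) = (\<Sum>i\<in>J. f i) + (\<Sum>i\<in>-J. f i)" for f :: "'n \<Rightarrow> real"
    by (subst sum.union_disjoint[symmetric]) auto
  show ?thesis
    unfolding vi_gap_coordinates split
    using x by (auto simp: coord_proj_def coord_subspace_def intro!: sum.cong)
qed

text \<open>Passage from the restricted problem to the full one. A point that satisfies the
variational inequality near itself inside the coordinate subspace satisfies it on the whole
subspace. Outside \<open>J\<close> strict dual feasibility makes every nonzero coordinate cost something, so
the inequality holds everywhere and all solutions lie in the subspace. Finally, solutions form a
convex set, so a second solution would produce one arbitrarily close to \<open>x\<close>, against local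
uniqueness.\<close>

lemma unique_solution_from_restricted_minimizer:
  fixes A :: "real^'n^'m" and h :: "real^'m \<Rightarrow> real"
  assumes conv: "convex_on UNIV h" and lam: "0 \<le> lam" and g: "GDERIV h (A *v x - b) :> g"
    and x: "x \<in> coord_subspace J" and e: "0 < e"
    and near: "\<And>w. w \<in> coord_subspace J \<Longrightarrow> dist x w \<le> e \<Longrightarrow> 0 \<le> vi_gap A g lam x w"
    and strict: "\<And>i. i \<notin> J \<Longrightarrow> \<bar>column i A \<bullet> g\<bar> < lam"
    and uniq: "\<And>w. w \<in> coord_subspace J \<Longrightarrow> dist x w \<le> e \<Longrightarrow> w \<in> sol_map h A (b, lam) \<Longrightarrow> w = x"
  shows "sol_map h A (b, lam) = {x}"
proof -
  let ?r = "\<lambda>z i. z $ i * (column i A \<bullet> g) + lam * \<bar>z $ i\<bar>"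
  have rest_pos: "0 < ?r z i" if "i \<notin> J" "z $ i \<noteq> 0" for z :: "real^'n" and i
  proof -
    have "- (z $ i * (column i A \<bullet> g)) \<le> \<bar>column i A \<bullet> g\<bar> * \<bar>z $ i\<bar>"
      by (metis abs_ge_minus_self abs_mult mult.commute)
    also have "\<dots> < lam * \<bar>z $ i\<bar>" using strict that by simp
    finally show ?thesis by simp
  qed
  then have rest: "0 \<le> ?r z i" if "i \<notin> J" for z i
    using that by (cases "z $ i = 0") (auto intro: less_imp_le)
  have proj: "0 \<le> vi_gap A g lam x (coord_proj J z)" for z
    by (rule vi_gap_nonneg_from_neighbourhood[OF subspace_coord_subspace x coord_proj_in e lam near])
  have gap: "(\<Sum>i\<in>-J. ?r z i) \<le> vi_gap A g lam x z" for z
    using proj[of z] vi_gap_split_coord_proj[OF x, of A g lam z] by simp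
  have gap0: "0 \<le> vi_gap A g lam x z" for z
    using gap[of z] sum_nonneg[of "-J" "?r z"] rest by force
  have sol: "x \<in> sol_map h A (b, lam)"
    unfolding sol_map_iff using objective_ge_vi_gap[OF conv g, of lam] gap0 by (smt (verit))
  have "z = x" if z: "z \<in> sol_map h A (b, lam)" for z
  proof -
    have "vi_gap A g lam x z \<le> 0"
      using objective_ge_vi_gap[OF conv g, of lam z] z unfolding sol_map_iff by (smt (verit))
    then have "(\<Sum>i\<in>-J. ?r z i) \<le> 0" using gap[of z] by linarith
    then have "(\<Sum>i\<in>-J. ?r z i) = 0" using sum_nonneg[of "-J" "?r z"] rest by force
    then have "?r z i = 0" if "i \<notin> J" for i
      using sum_nonneg_eq_0_iff[of "-J" "?r z"] rest that by force
    then have zX: "z \<in> coord_subspace J"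
      using rest_pos unfolding coord_subspace_def by force
    obtain t where t: "0 < t" "t \<le> 1"
      and step: "x + t *\<^sub>R (z - x) \<in> coord_subspace J" "dist x (x + t *\<^sub>R (z - x)) \<le> e"
      using short_step_in_subspace[OF subspace_coord_subspace x zX e] .
    define w where "w = x + t *\<^sub>R (z - x)"
    have "w \<in> sol_map h A (b, lam)"
    proof -
      have "objective h A b lam w \<le> objective h A b lam x"
      proof -
        have "A *v w - b = (1 - t) *\<^sub>R (A *v x - b) + t *\<^sub>R (A *v z - b)"
          unfolding w_def residual_along_segment by (simp add: matrix_vector_mult_diff_distrib algebra_simps)
        then have "h (A *v w - b) \<le> (1 - t) * h (A *v x - b) + t * h (A *v z - b)"
          using convex_onD[OF conv, of t "A *v x - b" "A *v z - b"] t by simp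
        moreover have "lam * l1_norm w \<le> lam * (l1_norm x + t * (l1_norm z - l1_norm x))"
          using l1_norm_convex_combination[of t x z] t lam by (intro mult_left_mono) (auto simp: w_def)
        ultimately have "objective h A b lam w
            \<le> objective h A b lam x + t * (objective h A b lam z - objective h A b lam x)"
          by (simp add: objective_def algebra_simps)
        moreover have "objective h A b lam z \<le> objective h A b lam x"
          using z by (simp add: sol_map_iff)
        ultimately show ?thesis using t by (smt (verit) mult_pos_pos mult_nonneg_nonpos)
      qed
      then show ?thesis using sol unfolding sol_map_iff by (meson order_trans)
    qed
    then have "w = x" using uniq[of w] step by (simp add: w_def[symmetric])
    then show "z = x" using t by (simp add: w_def)
  qed
  with sol show ?thesis by blast
qed

text \<open>Add the variational inequalities of the two solutions, each tested with the other.
Strong monotonicity, applied with the same parameter \<open>b1\<close> in both gradients \<open>g1\<close> and \<open>g12\<close>,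
bounds \<open>(norm (x1 - x2))\<^sup>2\<close> by terms that are linear in \<open>norm (x1 - x2)\<close> and in the change
of the parameters.\<close>

lemma variational_lipschitz_estimate:
  fixes A :: "real^'n^'m"
  assumes mono: "c * (norm (x1 - x2))\<^sup>2 \<le> (g1 - g12) \<bullet> (A *v (x1 - x2))"
    and lip: "norm (g12 - g2) \<le> L * norm (b1 - b2)"
    and K: "norm (A *v (x1 - x2)) \<le> K * norm (x1 - x2)"
    and vi1: "0 \<le> vi_gap A g1 lam1 x1 x2" and vi2: "0 \<le> vi_gap A g2 lam2 x2 x1"
    and nonneg: "0 \<le> L" "0 \<le> K"
  shows "c * norm (x1 - x2) \<le> L * K * norm (b1 - b2) + real CARD('n) * \<bar>lam1 - lam2\<bar>"
proof (cases "x1 = x2")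
  case False
  define n where "n = norm (x1 - x2)"
  have n: "0 < n" using False by (simp add: n_def)
  define d where "d = A *v (x1 - x2)"
  have "A *v (x2 - x1) = - d" by (simp add: d_def matrix_vector_mult_diff_distrib)
  then have "0 \<le> lam1 * (l1_norm x2 - l1_norm x1) - g1 \<bullet> d" using vi1 by (simp add: vi_gap_def)
  moreover have "0 \<le> lam2 * (l1_norm x1 - l1_norm x2) + g2 \<bullet> d" using vi2 by (simp add: vi_gap_def d_def)
  ultimately have "(g1 - g2) \<bullet> d \<le> (lam1 - lam2) * (l1_norm x2 - l1_norm x1)"
    by (simp add: inner_diff_left algebra_simps)
  also have "\<dots> \<le> \<bar>lam1 - lam2\<bar> * \<bar>l1_norm x2 - l1_norm x1\<bar>"
    by (metis abs_ge_self abs_mult)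
  also have "\<dots> \<le> \<bar>lam1 - lam2\<bar> * (real CARD('n) * n)"
    using l1_norm_diff_le[of x2 x1] by (intro mult_left_mono) (auto simp: n_def norm_minus_commute)
  finally have 1: "(g1 - g2) \<bullet> d \<le> \<bar>lam1 - lam2\<bar> * (real CARD('n) * n)" .
  have "(g2 - g12) \<bullet> d \<le> norm (g2 - g12) * norm d" by (rule norm_cauchy_schwarz)
  also have "\<dots> \<le> (L * norm (b1 - b2)) * (K * n)"
    using lip K nonneg by (intro mult_mono) (auto simp: d_def n_def norm_minus_commute)
  finally have 2: "(g2 - g12) \<bullet> d \<le> (L * norm (b1 - b2)) * (K * n)" .
  have "c * n\<^sup>2 \<le> (g1 - g2) \<bullet> d + (g2 - g12) \<bullet> d"
    using mono by (simp add: n_def d_def inner_diff_left)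
  also have "\<dots> \<le> \<bar>lam1 - lam2\<bar> * (real CARD('n) * n) + (L * norm (b1 - b2)) * (K * n)"
    using 1 2 by linarith
  finally have "n * (c * n) \<le> n * (L * K * norm (b1 - b2) + real CARD('n) * \<bar>lam1 - lam2\<bar>)"
    by (simp add: power2_eq_square algebra_simps)
  then show ?thesis using n unfolding n_def[symmetric] by (rule mult_left_le_imp_le)
qed (use nonneg in simp)

section \<open>Local Lipschitz solution map\<close>

text \<open>The restricted problem minimizes the objective over the points of the coordinate
subspace in a small ball around \<open>x\<close>. On this set the gradient is strongly monotone, uniformly in
the parameters, so the restricted minimizer exists, is unique and depends on the parameters in a
Lipschitz way. For parameters close to \<open>(b, lam)\<close> it stays in the interior of the ball and the
strict inequalities outside \<open>J\<close> persist, so it is the only solution of the full problem. The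
coercivity of the Hessian is passed on for the differentiability proof.\<close>

lemma local_lipschitz_solution_map:
  fixes A :: "real^'n^'m" and h :: "real^'m \<Rightarrow> real" and g :: "real^'m \<Rightarrow> real^'m"
  assumes h_cont: "continuous_on UNIV h" and conv: "convex_on UNIV h" and lam: "0 < lam"
    and sol: "x \<in> sol_map h A (b, lam)"
    and V: "open V" "A *v x - b \<in> V"
    and g: "\<And>z. z \<in> V \<Longrightarrow> GDERIV h z :> g z"
    and g': "\<And>z. z \<in> V \<Longrightarrow> (g has_derivative blinfun_apply (g' z)) (at z)"
    and g'_cont: "continuous_on V g'"
    and J: "J = {i. \<bar>column i A \<bullet> g (A *v x - b)\<bar> = lam}"
    and pos: "\<And>w. w \<in> coord_subspace J \<Longrightarrow> w \<noteq> 0 \<Longrightarrow> 0 < g' (A *v x - b) (A *v w) \<bullet> (A *v w)"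
  obtains U s L c where "open U" "(b, lam) \<in> U" "U \<subseteq> UNIV \<times> {0<..}" "L-lipschitz_on U s"
    "\<And>q. q \<in> U \<Longrightarrow> sol_map h A q = {s q}"
    "\<And>q. q \<in> U \<Longrightarrow> s q \<in> coord_subspace J"
    "\<And>q. q \<in> U \<Longrightarrow> A *v s q - fst q \<in> V" "0 < c"
    "\<And>q w. q \<in> U \<Longrightarrow> w \<in> coord_subspace J \<Longrightarrow>
       c * (norm w)\<^sup>2 \<le> g' (A *v s q - fst q) (A *v w) \<bullet> (A *v w)"
proof -
  define X :: "(real^'n) set" where "X = coord_subspace J"
  define y where "y = A *v x - b"
  have X: "subspace X" by (simp add: X_def subspace_coord_subspace)
  have yV: "y \<in> V" using V by (simp add: y_def)
  have gap: "0 \<le> vi_gap A (g y) lam x z" for z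
    using sol g[OF yV] lam unfolding y_def sol_map_iff
    by (intro minimizer_vi_gap_nonneg[of UNIV]) auto
  have "\<bar>column i A \<bullet> g y\<bar> = lam" if "x $ i \<noteq> 0" for i
    using solution_coordinate_conditions(2)[OF gap less_imp_le[OF lam] that] lam that
    by (simp add: abs_mult abs_sgn_eq)
  then have xX: "x \<in> X"
    unfolding X_def coord_subspace_def J y_def[symmetric] by blast
  have strict: "\<bar>column i A \<bullet> g y\<bar> < lam" if "i \<notin> J" for i
    using solution_coordinate_conditions(1)[OF gap less_imp_le[OF lam], of i] that
    by (auto simp: J y_def[symmetric])

  obtain K where K: "0 < K" and normA: "\<And>w. norm (A *v w) \<le> K * norm w"
    using bounded_linear.pos_bounded[OF matrix_vector_mul_bounded_linear[of A]]
    by (auto simp: mult.commute)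
  obtain c0 where c0: "0 < c0" and coer0: "\<And>w. w \<in> X \<Longrightarrow> c0 * (norm w)\<^sup>2 \<le> g' y (A *v w) \<bullet> (A *v w)"
    using quadratic_form_coercive_on_subspace[where T = "(*v) A" and H = "blinfun_apply (g' y)", OF X
        matrix_vector_mul_linear bounded_linear.linear[OF blinfun.bounded_linear_right]] pos
    by (auto simp: X_def y_def)
  define c where "c = c0 / 2"
  have c: "0 < c" using c0 by (simp add: c_def)
  define \<eta> where "\<eta> = c / K\<^sup>2"
  have \<eta>: "0 < \<eta>" "\<eta> * K\<^sup>2 = c" using c K by (auto simp: \<eta>_def)
  obtain \<epsilon> where \<epsilon>: "0 < \<epsilon>" "cball y \<epsilon> \<subseteq> V"
    and g'_near: "\<And>z. z \<in> cball y \<epsilon> \<Longrightarrow> norm (g' z - g' y) \<le> \<eta>"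
    and strict_diff: "\<And>z z'. z \<in> cball y \<epsilon> \<Longrightarrow> z' \<in> cball y \<epsilon> \<Longrightarrow>
        norm (g z - g z' - g' y (z - z')) \<le> \<eta> * norm (z - z')"
    using C1_strictly_differentiable[OF V(1) yV g' g'_cont \<eta>(1)] by blast
  \<comment> \<open>The constant \<open>\<eta>\<close> is chosen so that an error of this size costs exactly
    half of the coercivity constant \<open>c0\<close>.\<close>
  have perturb: "c * (norm w)\<^sup>2 \<le> u \<bullet> (A *v w)"
    if w: "w \<in> X" and u: "norm (u - g' y (A *v w)) \<le> \<eta> * norm (A *v w)" for u w
  proof -
    have "(g' y (A *v w) - u) \<bullet> (A *v w) \<le> norm (g' y (A *v w) - u) * norm (A *v w)"
      by (rule norm_cauchy_schwarz)
    also have "\<dots> \<le> (\<eta> * norm (A *v w)) * norm (A *v w)"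
      using u by (intro mult_right_mono) (auto simp: norm_minus_commute)
    also have "\<dots> = \<eta> * (norm (A *v w))\<^sup>2" by (simp add: power2_eq_square)
    also have "\<dots> \<le> \<eta> * (K * norm w)\<^sup>2"
      using \<eta> normA by (intro mult_left_mono power_mono) auto
    also have "\<dots> = c * (norm w)\<^sup>2" using \<eta>(2) by (simp add: power_mult_distrib)
    finally show ?thesis using coer0[OF w] by (simp add: c_def inner_diff_left)
  qed
  have coer: "c * (norm w)\<^sup>2 \<le> g' z (A *v w) \<bullet> (A *v w)" if "w \<in> X" "z \<in> cball y \<epsilon>" for w z
  proof (rule perturb[OF that(1)])
    have "norm (g' z (A *v w) - g' y (A *v w)) \<le> norm (g' z - g' y) * norm (A *v w)"
      unfolding blinfun.diff_left[symmetric] by (rule norm_blinfun)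
    also have "\<dots> \<le> \<eta> * norm (A *v w)" using g'_near[OF that(2)] by (intro mult_right_mono) auto
    finally show "norm (g' z (A *v w) - g' y (A *v w)) \<le> \<eta> * norm (A *v w)" .
  qed
  have mono: "c * (norm (w1 - w2))\<^sup>2 \<le> (g (A *v w1 - b') - g (A *v w2 - b')) \<bullet> (A *v (w1 - w2))"
    if "w1 \<in> X" "w2 \<in> X" "A *v w1 - b' \<in> cball y \<epsilon>" "A *v w2 - b' \<in> cball y \<epsilon>" for w1 w2 b'
    using strict_diff[OF that(3,4)] that(1,2) X
    by (intro perturb) (auto simp: subspace_diff matrix_vector_mult_diff_distrib)
  define L where "L = norm (g' y) + \<eta>"
  have lip: "norm (g z - g z') \<le> L * norm (z - z')" if "z \<in> cball y \<epsilon>" "z' \<in> cball y \<epsilon>" for z z'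
  proof -
    have "norm (g z - g z') \<le> norm (g z - g z' - g' y (z - z')) + norm (g' y (z - z'))"
      by (metis diff_add_cancel norm_triangle_ineq)
    then show ?thesis
      using strict_diff[OF that] norm_blinfun[of "g' y" "z - z'"] by (simp add: L_def algebra_simps)
  qed
  have L: "0 \<le> L" using \<eta> by (simp add: L_def)

  \<comment> \<open>Strict dual feasibility outside \<open>J\<close> is an open condition on the residual and
    the weight.\<close>
  have "\<forall>\<^sub>F p in nhds (y, lam). \<forall>i\<in>-J. \<bar>column i A \<bullet> g (fst p)\<bar> < snd p"
  proof (intro eventually_ball_finite ballI)
    fix i assume i: "i \<in> - J"
    have "isCont g y" using g'[OF yV] has_derivative_continuous by blast
    then have "isCont (\<lambda>p. g (fst p)) (y, lam)" by (intro isCont_o2[where g = g and f = fst]) auto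
    moreover define F where "F p = snd p - \<bar>column i A \<bullet> g (fst p)\<bar>" for p
    ultimately have "isCont F (y, lam)" unfolding F_def[abs_def] by (intro continuous_intros)
    then have "(F \<longlongrightarrow> F (y, lam)) (nhds (y, lam))"
      unfolding isCont_def tendsto_at_iff_tendsto_nhds .
    then have "\<forall>\<^sub>F p in nhds (y, lam). 0 < F p"
      by (rule order_tendstoD(1)) (use strict i in \<open>auto simp: F_def\<close>)
    then show "\<forall>\<^sub>F p in nhds (y, lam). \<bar>column i A \<bullet> g (fst p)\<bar> < snd p"
      by eventually_elim (simp add: F_def)
  qed auto
  then obtain \<delta> where \<delta>: "0 < \<delta>"
    and feas: "\<And>z \<mu> i. dist (z, \<mu>) (y, lam) < \<delta> \<Longrightarrow> i \<notin> J \<Longrightarrow> \<bar>column i A \<bullet> g z\<bar> < \<mu>"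
    unfolding eventually_nhds_metric by fastforce

  \<comment> \<open>The radii ensure that residuals stay within \<open>\<rho>\<close> of \<open>y\<close>: half of
    \<open>\<rho>\<close> is spent on moving the point by \<open>r\<close>, half on moving \<open>b\<close>.\<close>
  define \<rho> where "\<rho> = min \<epsilon> (\<delta> / 3)"
  define r where "r = \<rho> / (2 * K)"
  define C where "C = cball x r \<inter> X"
  define W where "W = {q :: (real^'m) \<times> real. norm (fst q - b) < \<rho> / 2 \<and> \<bar>snd q - lam\<bar> < \<rho> / 2 \<and> 0 < snd q}"
  have \<rho>: "0 < \<rho>" "\<rho> \<le> \<epsilon>" "\<rho> \<le> \<delta> / 3" using \<epsilon> \<delta> by (auto simp: \<rho>_def)
  have r: "0 < r" using \<rho> K by (simp add: r_def)
  have C: "compact C" "convex C" "x \<in> C"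
    using X xX r by (auto simp: C_def compact_Int_closed closed_subspace subspace_imp_convex convex_Int)
  have res: "A *v w - fst q \<in> cball y \<rho>" if "w \<in> C" "q \<in> W" for w q
  proof -
    have "A *v w - fst q - y = A *v (w - x) - (fst q - b)"
      by (simp add: y_def matrix_vector_mult_diff_distrib)
    then have "norm (A *v w - fst q - y) \<le> norm (A *v (w - x)) + norm (fst q - b)"
      using norm_triangle_ineq4 by metis
    also have "norm (A *v (w - x)) \<le> K * r"
      using normA[of "w - x"] that K
      by (auto simp: C_def dist_norm norm_minus_commute intro: order_trans mult_left_mono)
    also have "K * r = \<rho> / 2" using K by (simp add: r_def)
    finally show ?thesis using that by (simp add: W_def dist_norm norm_minus_commute)
  qed
  have res\<epsilon>: "A *v w - fst q \<in> cball y \<epsilon>" if "w \<in> C" "q \<in> W" for w q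
    using res[OF that] \<rho> by auto

  define VI where "VI q w \<longleftrightarrow> w \<in> C \<and> (\<forall>z\<in>C. 0 \<le> vi_gap A (g (A *v w - fst q)) (snd q) w z)" for q w
  have min_VI: "VI q w"
    if "q \<in> W" "w \<in> C" "\<And>z. z \<in> C \<Longrightarrow> objective h A (fst q) (snd q) w \<le> objective h A (fst q) (snd q) z"
    for q w
    unfolding VI_def
  proof (intro conjI ballI)
    fix z assume "z \<in> C"
    show "0 \<le> vi_gap A (g (A *v w - fst q)) (snd q) w z"
    proof (rule minimizer_vi_gap_nonneg[OF C(2) that(2) \<open>z \<in> C\<close> _ g that(3)])
      show "0 \<le> snd q" using that by (simp add: W_def)
      show "A *v w - fst q \<in> V" using res\<epsilon>[OF that(2,1)] \<epsilon> by blast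
    qed
  qed (use that in auto)
  have ex_VI: "\<exists>w. VI q w" if q: "q \<in> W" for q
  proof -
    have "continuous_on C (objective h A (fst q) (snd q))"
      unfolding objective_def[abs_def]
      by (intro continuous_on_add continuous_on_mult continuous_on_l1_norm continuous_on_const
          continuous_on_compose2[OF h_cont] continuous_on_diff linear_continuous_on
          matrix_vector_mul_bounded_linear) auto
    then obtain w where "w \<in> C" "\<And>z. z \<in> C \<Longrightarrow> objective h A (fst q) (snd q) w \<le> objective h A (fst q) (snd q) z"
      using continuous_attains_inf[of C "objective h A (fst q) (snd q)"] C by blast
    then show ?thesis using min_VI[OF q] by blast
  qed

  define M where "M = (L * K + real CARD('n)) / c"
  have M: "0 \<le> M" using L K c by (simp add: M_def)
  have est: "dist w1 w2 \<le> M * dist q1 q2" if q: "q1 \<in> W" "q2 \<in> W" and vi: "VI q1 w1" "VI q2 w2" for q1 q2 w1 w2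
  proof -
    have w: "w1 \<in> C" "w2 \<in> C" using vi by (auto simp: VI_def)
    have "c * norm (w1 - w2) \<le> L * K * norm (fst q1 - fst q2) + real CARD('n) * \<bar>snd q1 - snd q2\<bar>"
    proof (rule variational_lipschitz_estimate)
      show "c * (norm (w1 - w2))\<^sup>2 \<le> (g (A *v w1 - fst q1) - g (A *v w2 - fst q1)) \<bullet> (A *v (w1 - w2))"
        using w q by (intro mono res\<epsilon>) (auto simp: C_def)
      have "norm (g (A *v w2 - fst q1) - g (A *v w2 - fst q2)) \<le> L * norm ((A *v w2 - fst q1) - (A *v w2 - fst q2))"
        using w q by (intro lip res\<epsilon>)
      then show "norm (g (A *v w2 - fst q1) - g (A *v w2 - fst q2)) \<le> L * norm (fst q1 - fst q2)"
        by (simp add: norm_minus_commute)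
      show "0 \<le> vi_gap A (g (A *v w1 - fst q1)) (snd q1) w1 w2"
        "0 \<le> vi_gap A (g (A *v w2 - fst q2)) (snd q2) w2 w1"
        using vi w by (auto simp: VI_def)
    qed (use normA L K in auto)
    also have "\<dots> \<le> L * K * dist q1 q2 + real CARD('n) * dist q1 q2"
      using L K dist_fst_le[of q1 q2] dist_snd_le[of q1 q2]
      by (intro add_mono mult_left_mono) (auto simp: dist_norm)
    finally show ?thesis using c by (simp add: M_def dist_norm field_simps)
  qed
  have base: "(b, lam) \<in> W" using \<rho> lam by (simp add: W_def)
  have VI_base: "VI (b, lam) x"
    using gap C by (simp add: VI_def y_def)

  \<comment> \<open>With this radius solutions stay within \<open>r / 2\<close> of \<open>x\<close>, so points of the
    subspace within \<open>r / 2\<close> of a solution lie in \<open>C\<close>.\<close>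
  define d where "d = r / (2 * (M + 1))"
  have d: "0 < d" "M * d \<le> r / 2"
    using r M by (auto simp: d_def field_simps)
  define U where "U = W \<inter> ball (b, lam) d"
  define s where "s q = (SOME w. VI q w)" for q
  have s: "VI q (s q)" if "q \<in> U" for q
    unfolding s_def by (rule someI_ex, rule ex_VI) (use that in \<open>simp add: U_def\<close>)
  have sC: "s q \<in> C" if "q \<in> U" for q using s[OF that] by (simp add: VI_def)
  show thesis
  proof (rule that[of U M s c])
    have "open W"
      unfolding W_def by (intro open_Collect_conj open_Collect_less continuous_intros)
    then show "open U" by (simp add: U_def open_Int)
    show "(b, lam) \<in> U" using base d by (simp add: U_def)
    show "U \<subseteq> UNIV \<times> {0<..}" by (auto simp: U_def W_def)
    show "M-lipschitz_on U s"
      using est s M by (intro lipschitz_onI) (auto simp: U_def)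
    show "s q \<in> coord_subspace J" if "q \<in> U" for q using sC[OF that] by (simp add: C_def X_def)
    show "A *v s q - fst q \<in> V" if "q \<in> U" for q
    proof -
      have "q \<in> W" using that by (simp add: U_def)
      from res\<epsilon>[OF sC[OF that] this] show ?thesis using \<epsilon>(2) by blast
    qed
    show "0 < c" by (rule c)
    show "c * (norm w)\<^sup>2 \<le> g' (A *v s q - fst q) (A *v w) \<bullet> (A *v w)"
      if "q \<in> U" "w \<in> coord_subspace J" for q w
    proof -
      have "q \<in> W" using that by (simp add: U_def)
      from res\<epsilon>[OF sC[OF that(1)] this] show ?thesis
        using that(2) unfolding X_def[symmetric] by (intro coer)
    qed
    show "sol_map h A q = {s q}" if q: "q \<in> U" for q
    proof -
      have qW: "q \<in> W" using q by (simp add: U_def)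
      have near: "dist x (s q) \<le> r / 2"
      proof -
        have "dist x (s q) \<le> M * dist (b, lam) q" by (rule est[OF base qW VI_base s[OF q]])
        also have "\<dots> \<le> M * d" using q M by (intro mult_left_mono) (auto simp: U_def)
        finally show ?thesis using d by simp
      qed
      have inC: "w \<in> C" if "w \<in> coord_subspace J" "dist (s q) w \<le> r / 2" for w
        using that near dist_triangle[of x w "s q"] by (simp add: C_def X_def)
      have "sol_map h A (fst q, snd q) = {s q}"
      proof (rule unique_solution_from_restricted_minimizer[OF conv])
        show "0 \<le> snd q" using qW by (simp add: W_def)
        show "GDERIV h (A *v s q - fst q) :> g (A *v s q - fst q)"
          using res\<epsilon>[OF sC[OF q] qW] \<epsilon> by (intro g) blast
        show "s q \<in> coord_subspace J" using sC[OF q] by (simp add: C_def X_def)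
        show "0 < r / 2" using r by simp
        show "0 \<le> vi_gap A (g (A *v s q - fst q)) (snd q) (s q) w"
          if "w \<in> coord_subspace J" "dist (s q) w \<le> r / 2" for w
          using s[OF q] inC[OF that] by (simp add: VI_def)
        show "\<bar>column i A \<bullet> g (A *v s q - fst q)\<bar> < snd q" if "i \<notin> J" for i
        proof (rule feas[OF _ that])
          have "dist (A *v s q - fst q, snd q) (y, lam) \<le> dist (A *v s q - fst q) y + dist (snd q) lam"
            unfolding dist_Pair_Pair using sqrt_sum_squares_le_sum by simp
          also have "\<dots> < \<rho> + \<rho> / 2"
          proof (rule add_le_less_mono)
            show "dist (A *v s q - fst q) y \<le> \<rho>" using res[OF sC[OF q] qW] by (simp add: dist_commute)
            show "dist (snd q) lam < \<rho> / 2" using qW by (simp add: W_def dist_real_def)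
          qed
          also have "\<dots> < \<delta>" using \<rho> \<delta> by simp
          finally show "dist (A *v s q - fst q, snd q) (y, lam) < \<delta>" .
        qed
        show "w = s q" if w: "w \<in> coord_subspace J" "dist (s q) w \<le> r / 2" "w \<in> sol_map h A (fst q, snd q)" for w
        proof -
          have "VI q w"
            using w(3) unfolding sol_map_iff by (intro min_VI[OF qW inC[OF w(1,2)]]) blast
          from est[OF qW qW this s[OF q]] show ?thesis by simp
        qed
      qed
      then show ?thesis by simp
    qed
  qed
qed

section \<open>Continuous differentiability on a fixed support\<close>

lemma coercive_blinfun_inverse:
  fixes M :: "'a::euclidean_space \<Rightarrow>\<^sub>L 'a"
  assumes c: "0 < c" and coer: "\<And>v. c * (norm v)\<^sup>2 \<le> M v \<bullet> v"
  shows "\<exists>N. N o\<^sub>L M = id_blinfun \<and> M o\<^sub>L N = id_blinfun \<and> norm N \<le> 1 / c"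
proof -
  have below: "c * norm v \<le> norm (M v)" for v
  proof (cases "v = 0")
    case False
    have "norm v * (c * norm v) \<le> norm v * norm (M v)"
      using coer[of v] norm_cauchy_schwarz[of "M v" v] by (simp add: power2_eq_square algebra_simps)
    then show ?thesis using False by simp
  qed simp
  have lin: "linear (blinfun_apply M)" by (rule bounded_linear.linear[OF blinfun.bounded_linear_right])
  have "inj (blinfun_apply M)"
    unfolding linear_injective_0[OF lin]
  proof (intro allI impI)
    fix v assume "M v = 0"
    then show "v = 0" using below[of v] c by (simp add: mult_le_0_iff)
  qed
  from linear_injective_isomorphism[OF lin this] obtain f
    where f: "linear f" "\<And>v. f (M v) = v" "\<And>v. M (f v) = v" by blast
  have bl: "bounded_linear f" using f(1) by (simp add: linear_conv_bounded_linear)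
  define N where "N = Blinfun f"
  have N: "N v = f v" for v unfolding N_def by (simp add: bounded_linear_Blinfun_apply[OF bl])
  have "norm N \<le> 1 / c"
  proof (rule norm_blinfun_bound)
    show "norm (N v) \<le> 1 / c * norm v" for v
      using below[of "N v"] c by (simp add: N f field_simps)
  qed (use c in simp)
  moreover have "N o\<^sub>L M = id_blinfun" "M o\<^sub>L N = id_blinfun"
    by (auto intro!: blinfun_eqI simp: N f)
  ultimately show ?thesis by blast
qed

text \<open>The identity \<open>N q - N p = N q (M p - M q) N p\<close> turns a uniform bound on the inverses
into a Lipschitz estimate for inversion.\<close>

lemma continuous_on_bounded_inverse:
  fixes M N :: "'p::metric_space \<Rightarrow> ('a::euclidean_space \<Rightarrow>\<^sub>L 'a)"
  assumes cont: "continuous_on U M"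
    and inv: "\<And>q. q \<in> U \<Longrightarrow> N q o\<^sub>L M q = id_blinfun" "\<And>q. q \<in> U \<Longrightarrow> M q o\<^sub>L N q = id_blinfun"
    and bound: "\<And>q. q \<in> U \<Longrightarrow> norm (N q) \<le> B"
  shows "continuous_on U N"
  unfolding continuous_on_def
proof
  fix p assume p: "p \<in> U"
  have B: "0 \<le> B" using bound[OF p] norm_ge_zero order_trans by blast
  have le: "norm (N q - N p) \<le> B * B * norm (M q - M p)" if q: "q \<in> U" for q
  proof -
    have "N q - N p = N q o\<^sub>L (M p - M q) o\<^sub>L N p"
    proof (rule blinfun_eqI)
      fix v
      have "N q (M q (N p v)) = N p v"
        using inv(1)[OF q] by (metis blinfun_apply_blinfun_compose blinfun_apply_id_blinfun)
      moreover have "M p (N p v) = v"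
        using inv(2)[OF p] by (metis blinfun_apply_blinfun_compose blinfun_apply_id_blinfun)
      ultimately show "(N q - N p) v = (N q o\<^sub>L (M p - M q) o\<^sub>L N p) v"
        by (simp add: blinfun.diff_left blinfun.diff_right)
    qed
    then have "norm (N q - N p) \<le> norm (N q o\<^sub>L (M p - M q)) * norm (N p)"
      by (simp add: norm_blinfun_compose)
    also have "\<dots> \<le> (norm (N q) * norm (M p - M q)) * norm (N p)"
      by (intro mult_right_mono norm_blinfun_compose) auto
    also have "\<dots> \<le> (B * norm (M p - M q)) * B"
      using bound[OF p] bound[OF q] B by (intro mult_mono) auto
    finally show ?thesis by (simp add: norm_minus_commute algebra_simps)
  qed
  have "((\<lambda>q. N q - N p) \<longlongrightarrow> 0) (at p within U)"
  proof (rule Lim_null_comparison)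
    show "\<forall>\<^sub>F q in at p within U. norm (N q - N p) \<le> B * B * norm (M q - M p)"
      using le by (simp add: eventually_at_filter)
    have "((\<lambda>q. B * B * norm (M q - M p)) \<longlongrightarrow> B * B * norm (M p - M p)) (at p within U)"
      using cont p unfolding continuous_on_def by (intro tendsto_intros) auto
    then show "((\<lambda>q. B * B * norm (M q - M p)) \<longlongrightarrow> 0) (at p within U)" by simp
  qed
  then show "(N \<longlongrightarrow> N p) (at p within U)" by (simp add: LIM_zero_cancel)
qed

lemma norm_sq_coord_proj: "(norm w)\<^sup>2 = (norm (coord_proj J w))\<^sup>2 + (norm (w - coord_proj J w))\<^sup>2"
proof -
  have "coord_proj J w \<bullet> (w - coord_proj J w) = 0"
    unfolding inner_vec_def by (rule sum.neutral) (simp add: coord_proj_def)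
  then show ?thesis
    using norm_add_Pythagorean[of "coord_proj J w" "w - coord_proj J w"] by (simp add: orthogonal_def)
qed

text \<open>On a fixed support with fixed signs the optimality conditions are smooth equations.
With \<open>T\<close> the restriction of \<open>A\<close> to the coordinate subspace they read
\<open>T\<^sup>* (g (y q)) = - snd q * \<sigma>\<close>. Since \<open>s\<close> is already known to be Lipschitz,
linearizing \<open>g\<close> at \<open>y q\<close> shows directly that the derivative of \<open>s\<close> is the solution of the
linearized equation, and this depends continuously on \<open>q\<close>.\<close>

lemma solution_map_C1_on_fixed_support:
  fixes A :: "real^'n^'m" and g :: "real^'m \<Rightarrow> real^'m" and s :: "(real^'m) \<times> real \<Rightarrow> real^'n"
  assumes U: "open U" and lip: "L-lipschitz_on U s"
    and X: "\<And>q. q \<in> U \<Longrightarrow> s q \<in> coord_subspace J"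
    and V: "\<And>q. q \<in> U \<Longrightarrow> A *v s q - fst q \<in> V"
    and g': "\<And>z. z \<in> V \<Longrightarrow> (g has_derivative blinfun_apply (g' z)) (at z)"
    and g'_cont: "continuous_on V g'"
    and c: "0 < c" and coer: "\<And>q w. q \<in> U \<Longrightarrow> w \<in> coord_subspace J \<Longrightarrow>
       c * (norm w)\<^sup>2 \<le> g' (A *v s q - fst q) (A *v w) \<bullet> (A *v w)"
    and stat: "\<And>q i. q \<in> U \<Longrightarrow> i \<in> J \<Longrightarrow> column i A \<bullet> g (A *v s q - fst q) = - snd q * \<sigma> $ i"
  shows "cont_diff_on U s"
proof -
  define y where "y q = A *v s q - fst q" for q
  define T :: "(real^'n) \<Rightarrow>\<^sub>L (real^'m)" where "T = Blinfun (\<lambda>w. A *v coord_proj J w)"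
  define Ts :: "(real^'m) \<Rightarrow>\<^sub>L (real^'n)" where "Ts = Blinfun (\<lambda>v. \<chi> i. if i \<in> J then column i A \<bullet> v else 0)"
  define Q :: "(real^'n) \<Rightarrow>\<^sub>L (real^'n)" where "Q = Blinfun (\<lambda>w. w - coord_proj J w)"
  define \<tau> where "\<tau> = coord_proj J \<sigma>"
  have linP: "linear (coord_proj J)"
    by (rule linearI) (auto simp: coord_proj_def vec_eq_iff)
  have T: "T w = A *v coord_proj J w" for w
  proof -
    have "linear (\<lambda>w. A *v coord_proj J w)"
      using linear_compose[OF linP matrix_vector_mul_linear[of A]] by (simp add: o_def)
    then show ?thesis by (simp add: T_def bounded_linear_Blinfun_apply linear_conv_bounded_linear)
  qed
  have Ts: "Ts v = (\<chi> i. if i \<in> J then column i A \<bullet> v else 0)" for v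
  proof -
    have "linear (\<lambda>v. \<chi> i. if i \<in> J then column i A \<bullet> v else 0)"
      by (rule linearI) (auto simp: vec_eq_iff inner_add_right)
    then show ?thesis by (simp add: Ts_def bounded_linear_Blinfun_apply linear_conv_bounded_linear)
  qed
  have Q: "Q w = w - coord_proj J w" for w
  proof -
    have "linear (\<lambda>w. w - coord_proj J w)"
      using linP by (intro linear_compose_sub linear_ident)
    then show ?thesis by (simp add: Q_def bounded_linear_Blinfun_apply linear_conv_bounded_linear)
  qed
  have adj: "Ts v \<bullet> w = v \<bullet> T w" for v w
  proof -
    have "v \<bullet> T w = (\<Sum>i\<in>UNIV. coord_proj J w $ i * (column i A \<bullet> v))"
      unfolding T by (rule inner_matrix_vector)
    also have "\<dots> = Ts v \<bullet> w"
      unfolding inner_vec_def Ts by (rule sum.cong) (auto simp: coord_proj_def)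
    finally show ?thesis by simp
  qed

  \<comment> \<open>The summand \<open>Q\<close> is the identity on the complementary coordinates: it makes
    the operator coercive on the whole space, and it vanishes on differences of values of
    \<open>s\<close>.\<close>
  define M where "M q = (Ts o\<^sub>L g' (y q) o\<^sub>L T) + Q" for q
  define c' where "c' = min c 1"
  have c': "0 < c'" using c by (simp add: c'_def)
  have coerM: "c' * (norm w)\<^sup>2 \<le> M q w \<bullet> w" if q: "q \<in> U" for q w
  proof -
    let ?p = "coord_proj J w"
    have orth: "(w - ?p) \<bullet> ?p = 0"
      unfolding inner_vec_def by (rule sum.neutral) (simp add: coord_proj_def)
    have "M q w \<bullet> w = g' (y q) (T w) \<bullet> T w + (w - ?p) \<bullet> w"
      by (simp add: M_def blinfun.add_left inner_add_left adj Q)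
    also have "(w - ?p) \<bullet> w = (norm (w - ?p))\<^sup>2"
      using orth by (simp add: power2_norm_eq_inner inner_diff_right)
    finally have "M q w \<bullet> w = g' (y q) (T w) \<bullet> T w + (norm (w - ?p))\<^sup>2" .
    moreover have "c * (norm ?p)\<^sup>2 \<le> g' (y q) (T w) \<bullet> T w"
      unfolding T y_def by (rule coer[OF q coord_proj_in])
    moreover have "c' * (norm ?p)\<^sup>2 \<le> c * (norm ?p)\<^sup>2" "c' * (norm (w - ?p))\<^sup>2 \<le> 1 * (norm (w - ?p))\<^sup>2"
      by (intro mult_right_mono; simp add: c'_def)+
    ultimately show ?thesis
      unfolding norm_sq_coord_proj[of w J] distrib_left by linarith
  qed
  have "\<forall>q. \<exists>N. q \<in> U \<longrightarrow> N o\<^sub>L M q = id_blinfun \<and> M q o\<^sub>L N = id_blinfun \<and> norm N \<le> 1 / c'"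
    using coercive_blinfun_inverse[OF c' coerM] by blast
  then obtain N where N: "\<And>q. q \<in> U \<Longrightarrow> N q o\<^sub>L M q = id_blinfun"
    "\<And>q. q \<in> U \<Longrightarrow> M q o\<^sub>L N q = id_blinfun" "\<And>q. q \<in> U \<Longrightarrow> norm (N q) \<le> 1 / c'"
    by metis

  define R where "R q = (Ts o\<^sub>L g' (y q) o\<^sub>L fst_blinfun) - (blinfun_scaleR_left \<tau> o\<^sub>L snd_blinfun)" for q
  have "continuous_on U s" by (rule lipschitz_on_continuous_on[OF lip])
  then have "continuous_on U y"
    unfolding y_def[abs_def]
    by (intro continuous_intros continuous_on_compose2[OF linear_continuous_on[OF matrix_vector_mul_bounded_linear]]) auto
  then have g'y: "continuous_on U (\<lambda>q. g' (y q))"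
    using V by (intro continuous_on_compose2[OF g'_cont]) (auto simp: y_def)
  have M_cont: "continuous_on U M"
    unfolding M_def[abs_def] by (intro continuous_intros g'y)
  have R_cont: "continuous_on U R"
    unfolding R_def[abs_def] by (intro continuous_intros g'y)
  have N_cont: "continuous_on U N"
    by (rule continuous_on_bounded_inverse[OF M_cont N])

  have deriv: "(s has_derivative blinfun_apply (N q o\<^sub>L R q)) (at q)" if q: "q \<in> U" for q
    unfolding has_derivative_at_alt
  proof (intro conjI allI impI blinfun.bounded_linear_right)
    fix e :: real assume e: "0 < e"
    obtain K where K: "0 < K" and normA: "\<And>w. norm (A *v w) \<le> K * norm w"
      using bounded_linear.pos_bounded[OF matrix_vector_mul_bounded_linear[of A]]
      by (auto simp: mult.commute)
    have L: "0 \<le> L" using lip by (rule lipschitz_on_nonneg)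
    define Ly where "Ly = K * L + 1"
    have Ly: "0 < Ly" using K L by (simp add: Ly_def add_nonneg_pos)
    have y_lip: "norm (y p - y q) \<le> Ly * norm (p - q)" if p: "p \<in> U" for p
    proof -
      have "y p - y q = A *v (s p - s q) - fst (p - q)"
        by (simp add: y_def matrix_vector_mult_diff_distrib)
      then have "norm (y p - y q) \<le> norm (A *v (s p - s q)) + norm (fst (p - q))"
        using norm_triangle_ineq4 by metis
      also have "\<dots> \<le> K * (L * norm (p - q)) + norm (p - q)"
        using normA[of "s p - s q"] lipschitz_onD[OF lip p q] K dist_fst_le[of p q]
        by (intro add_mono) (auto simp: dist_norm intro: order_trans mult_left_mono)
      finally show ?thesis by (simp add: Ly_def algebra_simps)
    qed
    define \<kappa> where "\<kappa> = norm (N q) * norm Ts + 1"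
    have \<kappa>: "0 < \<kappa>" by (simp add: \<kappa>_def add_nonneg_pos)
    define e' where "e' = e / (\<kappa> * Ly)"
    have e': "0 < e'" using e \<kappa> Ly by (simp add: e'_def)
    obtain d1 where d1: "0 < d1"
      and small: "\<And>z. norm (z - y q) < d1 \<Longrightarrow> norm (g z - g (y q) - g' (y q) (z - y q)) \<le> e' * norm (z - y q)"
      using g'[OF V[OF q]] e' unfolding has_derivative_at_alt y_def by blast
    obtain d2 where d2: "0 < d2" "ball q d2 \<subseteq> U" using U q open_contains_ball by blast
    have est: "norm (s p - s q - (N q o\<^sub>L R q) (p - q)) \<le> e * norm (p - q)"
      if p: "p \<in> U" and close: "norm (y p - y q) < d1" for p
    proof -
      \<comment> \<open>The error of the linear model for \<open>s\<close> is the image of the linearization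
        error of \<open>g\<close> between the residuals, which is small against their distance; \<open>s\<close> being
        Lipschitz, it is small against \<open>norm (p - q)\<close>.\<close>
      define err where "err = g (y p) - g (y q) - g' (y q) (y p - y q)"
      have stat': "Ts (g (y r)) = - snd r *\<^sub>R \<tau>" if "r \<in> U" for r
        using stat[OF that] by (auto simp: Ts y_def \<tau>_def coord_proj_def vec_eq_iff)
      have P: "coord_proj J (s p - s q) = s p - s q"
        using X[OF p] X[OF q] by (intro coord_proj_id subspace_diff[OF subspace_coord_subspace])
      have TD: "T (s p - s q) = (y p - y q) + fst (p - q)"
        unfolding T P by (simp add: y_def matrix_vector_mult_diff_distrib)
      have "M q (s p - s q) = Ts (g' (y q) (y p - y q)) + Ts (g' (y q) (fst (p - q)))"
        by (simp add: M_def blinfun.add_left Q P TD blinfun.add_right)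
      moreover have "R q (p - q) = Ts (g' (y q) (fst (p - q))) - snd (p - q) *\<^sub>R \<tau>"
        by (simp add: R_def blinfun.diff_left)
      moreover have "Ts err = - snd (p - q) *\<^sub>R \<tau> - Ts (g' (y q) (y p - y q))"
      proof -
        have "Ts err = Ts (g (y p)) - Ts (g (y q)) - Ts (g' (y q) (y p - y q))"
          unfolding err_def by (simp only: blinfun.diff_right)
        then show ?thesis by (simp add: stat'[OF p] stat'[OF q] algebra_simps)
      qed
      ultimately have "M q (s p - s q) - R q (p - q) = - Ts err"
        by (simp add: scaleR_left_diff_distrib)
      then have "N q (M q (s p - s q)) - N q (R q (p - q)) = - N q (Ts err)"
        by (metis blinfun.diff_right blinfun.minus_right)
      moreover have "N q (M q (s p - s q)) = s p - s q"
        using N(1)[OF q] by (metis blinfun_apply_blinfun_compose blinfun_apply_id_blinfun)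
      ultimately have "norm (s p - s q - (N q o\<^sub>L R q) (p - q)) = norm (N q (Ts err))" by simp
      also have "\<dots> \<le> norm (N q) * (norm Ts * norm err)"
        by (intro order_trans[OF norm_blinfun] mult_left_mono norm_blinfun) auto
      also have "\<dots> \<le> \<kappa> * norm err" by (simp add: \<kappa>_def algebra_simps)
      also have "\<dots> \<le> \<kappa> * (e' * (Ly * norm (p - q)))"
        using small[OF close] y_lip[OF p] e' \<kappa>
        by (intro mult_left_mono order_trans[OF small[OF close, folded err_def]]) auto
      also have "\<dots> = e * norm (p - q)" using \<kappa> Ly by (simp add: e'_def)
      finally show ?thesis .
    qed
    show "\<exists>d>0. \<forall>p. norm (p - q) < d \<longrightarrow> norm (s p - s q - (N q o\<^sub>L R q) (p - q)) \<le> e * norm (p - q)"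
    proof (intro exI[of _ "min d2 (d1 / Ly)"] conjI allI impI)
      show "0 < min d2 (d1 / Ly)" using d1 d2 Ly by simp
      fix p assume p: "norm (p - q) < min d2 (d1 / Ly)"
      then have pU: "p \<in> U" using d2 by (auto simp: dist_norm norm_minus_commute)
      have "Ly * norm (p - q) < d1" using p Ly by (simp add: field_simps)
      then show "norm (s p - s q - (N q o\<^sub>L R q) (p - q)) \<le> e * norm (p - q)"
        using y_lip[OF pU] by (intro est[OF pU]) linarith
    qed
  qed
  show ?thesis
    unfolding cont_diff_on_def
    using deriv by (intro exI[of _ "\<lambda>q. N q o\<^sub>L R q"] conjI ballI continuous_intros N_cont R_cont) auto
qed

section \<open>The solution map of the regularized problem\<close>

theorem theorem3p3:
  fixes A :: "real^'n^'m" and h :: "real^'m \<Rightarrow> real"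
    and b :: "real^'m" and lam :: real and x :: "real^'n"
  assumes h_nonneg: "\<And>y. 0 \<le> h y"
    and h_cont: "continuous_on UNIV h"
    and h_convex: "convex_on UNIV h"
    and lambda_pos: "0 < lam"
    and x_sol: "x \<in> sol_map h A (b, lam)"
    and h_C2: "twice_cont_diff_around h (A *v x - b)"
    and ker_rge: "{v. hessian h (A *v x - b) *v v = 0} \<inter> rge_cols A (J_set h A b lam x) = {0}"
    and full_rank: "full_column_rank A (J_set h A b lam x)"
  shows "locally_single_valued_lipschitz sol_dom (sol_map h A) (b, lam) \<and>
         (J_set h A b lam x = supp x \<longrightarrow> set_map_cont_diff_at sol_dom (sol_map h A) (b, lam))"
proof -
  define g where "g = gradient h"
  define J where "J = J_set h A b lam x"
  define y where "y = A *v x - b"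
  obtain V g' where V: "open V" "y \<in> V"
    and g: "\<And>z. z \<in> V \<Longrightarrow> GDERIV h z :> g z"
    and g': "\<And>z. z \<in> V \<Longrightarrow> (g has_derivative blinfun_apply (g' z)) (at z)"
    and g'_cont: "continuous_on V g'"
    using h_C2 gderiv_gradient
    unfolding twice_cont_diff_around_def cont_diff_on_def g_def y_def by blast
  have J: "J = {i. \<bar>column i A \<bullet> g (A *v x - b)\<bar> = lam}"
    by (simp add: J_def J_set_def g_def)
  have hess: "hessian h y *v v = g' y v" for v
  proof -
    have "frechet_derivative g (at y) = blinfun_apply (g' y)"
      using frechet_derivative_at[OF g'[OF V(2)]] by simp
    then show ?thesis
      unfolding hessian_def g_def[symmetric]
      by (simp add: matrix_works bounded_linear.linear blinfun.bounded_linear_right)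
  qed
  \<comment> \<open>The form is nonnegative and its zeros are null vectors of the Hessian, which
    the hypotheses on kernel and rank exclude.\<close>
  have pos: "0 < g' (A *v x - b) (A *v w) \<bullet> (A *v w)" if w: "w \<in> coord_subspace J" "w \<noteq> 0" for w
  proof -
    have "A *v w \<noteq> 0"
      using full_column_rank_trivial_kernel[OF full_rank] w unfolding J_def by blast
    moreover have "A *v w \<in> rge_cols A J" using w by (simp add: rge_cols_eq_image)
    ultimately have "hessian h y *v (A *v w) \<noteq> 0"
      using ker_rge unfolding J_def y_def by blast
    then have "g' y (A *v w) \<noteq> 0" by (simp add: hess)
    then have "g' y (A *v w) \<bullet> (A *v w) \<noteq> 0"
      using convex_hessian_null_vector[OF h_convex V g g'[OF V(2)]] by blast
    then show ?thesis
      using convex_hessian_nonneg[OF h_convex V g g'[OF V(2)], of "A *v w"] by (simp add: y_def)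
  qed
  obtain U s L c where U: "open U" "(b, lam) \<in> U" "U \<subseteq> UNIV \<times> {0<..}" and lip: "L-lipschitz_on U s"
    and single: "\<And>q. q \<in> U \<Longrightarrow> sol_map h A q = {s q}"
    and sX: "\<And>q. q \<in> U \<Longrightarrow> s q \<in> coord_subspace J"
    and sV: "\<And>q. q \<in> U \<Longrightarrow> A *v s q - fst q \<in> V" and c: "0 < c"
    and coer: "\<And>q w. q \<in> U \<Longrightarrow> w \<in> coord_subspace J \<Longrightarrow>
       c * (norm w)\<^sup>2 \<le> g' (A *v s q - fst q) (A *v w) \<bullet> (A *v w)"
    by (rule local_lipschitz_solution_map[OF h_cont h_convex lambda_pos x_sol V[unfolded y_def] g g' g'_cont J pos])
      (assumption | rule that | blast)+
  have dom: "U \<subseteq> sol_dom" using U(3) by (auto simp: sol_dom_def)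
  have "locally_single_valued_lipschitz sol_dom (sol_map h A) (b, lam)"
    unfolding locally_single_valued_lipschitz_def using U dom single lip by blast
  moreover have "set_map_cont_diff_at sol_dom (sol_map h A) (b, lam)" if supp: "J = supp x"
  proof -
    \<comment> \<open>Near the base point the coordinates in the support of \<open>x\<close> keep their
      signs.\<close>
    define W where "W = (\<Inter>i\<in>J. {w :: real^'n. 0 < w $ i * x $ i})"
    define U' where "U' = U \<inter> s -` W"
    have "open W"
      unfolding W_def by (intro open_INT ballI open_Collect_less continuous_intros) auto
    then have U': "open U'"
      unfolding U'_def by (intro continuous_open_preimage lipschitz_on_continuous_on[OF lip] U)
    have "s (b, lam) = x" using single[OF U(2)] x_sol by simp
    then have base: "(b, lam) \<in> U'"
      using U(2) supp by (auto simp: U'_def W_def supp_def zero_less_mult_iff)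
    have sub: "U' \<subseteq> U" by (simp add: U'_def)
    have stat: "column i A \<bullet> g (A *v s q - fst q) = - snd q * (\<chi> i. sgn (x $ i)) $ i"
      if q: "q \<in> U'" and i: "i \<in> J" for q i
    proof -
      have qU: "q \<in> U" using q sub by blast
      have mu: "0 \<le> snd q" using qU U(3) by auto
      have "s q \<in> sol_map h A (fst q, snd q)" using single[OF qU] by simp
      then have gap: "0 \<le> vi_gap A (g (A *v s q - fst q)) (snd q) (s q) z" for z
        using g[OF sV[OF qU]] mu unfolding sol_map_iff
        by (intro minimizer_vi_gap_nonneg[of UNIV]) auto
      have "0 < s q $ i * x $ i" using q i by (simp add: U'_def W_def)
      then have "s q $ i \<noteq> 0" "sgn (s q $ i) = sgn (x $ i)"
        by (auto simp: zero_less_mult_iff sgn_if)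
      then show ?thesis using solution_coordinate_conditions(2)[OF gap mu] by simp
    qed
    have "cont_diff_on U' s"
      by (rule solution_map_C1_on_fixed_support[OF U' lipschitz_on_subset[OF lip sub] sX sV g' g'_cont c coer stat])
         (use sub in auto)
    then show ?thesis
      unfolding set_map_cont_diff_at_def using U' base sub dom single by blast
  qed
  ultimately show ?thesis unfolding J_def by blast
qed

end
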